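(* Let $n\ge2$ and let $M$ be an $n$-dimensional Riemannian submanifold of the Minkowski space $\mathbb E^{n+2}_1$ lying on $\mathcal{LC}^n\times\mathbb R$, with frame field $\{e_1,\dots,e_n;\theta,\xi\}$ and function $\alpha$ as in the context, where $\alpha$ vanishes at no point of $M$. Then $M$ has flat normal bundle if and only if $e_a(\alpha)=0$ for all $a=2,\dots,n$.
   Context: $\mathbb E^{m}_1$ is $\mathbb R^m$ with the metric $\langle\cdot,\cdot\rangle=-dx_1^2+\sum_{i=2}^m dx_i^2$. The hypersurface $\mathcal{LC}^n\times\mathbb R\subset\mathbb E^{n+2}_1$ is $\{x: -x_1^2+x_2^2+\cdots+x_{n+1}^2=0,\ x_1>0\}$. For a Riemannian submanifold $M$, $h$, $A$, $\nabla^\perp$ denote the second fundamental form, shape operator and normal connection: $\widetilde\nabla_XY=\nabla_XY+h(X,Y)$, $\widetilde\nabla_X\zeta=-A_\zeta X+\nabla^\perp_X\zeta$. $M$ has flat normal bundle if the curvature tensor $R^\perp$ of $\nabla^\perp$ vanishes identically. Frame and invariants. Let $\phi=(\phi_1,\dots,\phi_{n+2})$ be the position vector of $M$. Put $\theta=(\phi_1,\dots,\phi_{n+1},0)$, a light-like normal field, and let $\xi$ be the normal field with $\langle\xi,\xi\rangle=0$, $\langle\xi,\theta\rangle=-1$. Let $e_1=(\partial_{x_{n+2}})^T$ be the tangential part of $\partial_{x_{n+2}}$ (a unit vector field), and let $\alpha\in C^\infty(M)$ be defined by $\nabla^\perp_{e_1}\theta=\alpha\theta$, equivalently $\partial_{x_{n+2}}|_M=e_1-\alpha\theta$.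 Let $D^\perp$ be the orthogonal complement of $\mathrm{span}\{e_1\}$ in $TM$, $\Pi:TM\to D^\perp$ the orthogonal projection, and $L=\Pi\circ A_\xi:D^\perp\to D^\perp$ (self-adjoint). Then $e_2,\dots,e_n$ is an orthonormal frame of $D^\perp$ consisting of eigenvectors of $L$. *)

theory Defs
  imports "HOL-Analysis.Analysis"
begin

section \<open>Smooth maps between normed spaces\<close>

primrec Ck_on :: "nat \<Rightarrow> 'a::real_normed_vector set \<Rightarrow> ('a \<Rightarrow> 'b::real_normed_vector) \<Rightarrow> bool" where
  "Ck_on 0 S f \<longleftrightarrow> continuous_on S f"
| "Ck_on (Suc k) S f \<longleftrightarrow>
     (\<forall>x\<in>S. f differentiable (at x)) \<and> (\<forall>v. Ck_on k S (\<lambda>x. frechet_derivative f (at x) v))"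

text \<open>Meaningful for open \<open>S\<close> only, since \<open>at x\<close> looks at a full neighbourhood of \<open>x\<close>.\<close>

definition smooth_on :: "'a::real_normed_vector set \<Rightarrow> ('a \<Rightarrow> 'b::real_normed_vector) \<Rightarrow> bool" where
  "smooth_on S f \<longleftrightarrow> (\<forall>k. Ck_on k S f)"

section \<open>Minkowski space and the cylinder over the light cone\<close>

text \<open>With \<open>n = CARD('n)\<close>, a point \<open>(t, y, s)\<close> stands for
  \<open>x\<^sub>1 = t\<close>, \<open>(x\<^sub>2, \<dots>, x\<^bsub>n+1\<^esub>) = y\<close>, \<open>x\<^bsub>n+2\<^esub> = s\<close>.\<close>

type_synonym 'n mink = "real \<times> (real ^ 'n) \<times> real"

definition lorentz :: "'n::finite mink \<Rightarrow> 'n mink \<Rightarrow> real" where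
  "lorentz u v = (case (u, v) of ((t, y, s), (t', y', s')) \<Rightarrow> - (t * t') + y \<bullet> y' + s * s')"

definition light_cone_cylinder :: "'n::finite mink set" where
  "light_cone_cylinder = {(t, y, s). - (t\<^sup>2) + (\<Sum>i\<in>UNIV. (y $ i)\<^sup>2) = 0 \<and> t > 0}"

definition axis_last :: "'n::finite mink" where
  "axis_last = (0, 0, 1)"

text \<open>The projection onto \<open>S\<close> along its \<open>lorentz\<close>-orthogonal complement; it is well defined
  whenever \<open>lorentz\<close> is nondegenerate on the subspace \<open>S\<close>.\<close>

definition orth_proj :: "'n::finite mink set \<Rightarrow> 'n mink \<Rightarrow> 'n mink" where
  "orth_proj S w = (THE u. u \<in> S \<and> (\<forall>v\<in>S. lorentz (w - u) v = 0))"

section \<open>Submanifolds\<close>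

text \<open>The atlas of a manifold is given by local parametrizations, that is, by pairs \<open>(V, g)\<close> with
  \<open>V\<close> open in \<open>real ^ 'n\<close> and \<open>g\<close> a homeomorphism from \<open>V\<close> onto an open subset of the manifold.\<close>

record ('a, 'n) submfd =
  topo :: "'a topology"
  atlas :: "((real ^ 'n::finite) set \<times> (real ^ 'n \<Rightarrow> 'a)) set"
  pos :: "'a \<Rightarrow> 'n mink"

abbreviation points :: "('a, 'n::finite) submfd \<Rightarrow> 'a set" where
  "points M \<equiv> topspace (topo M)"

definition smooth_manifold :: "('a, 'n::finite) submfd \<Rightarrow> bool" where
  "smooth_manifold M \<longleftrightarrow>
     Hausdorff_space (topo M) \<and> second_countable (topo M) \<and>
     (\<forall>(V, g)\<in>atlas M. open V \<and> openin (topo M) (g ` V) \<and>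
        homeomorphic_map (top_of_set V) (subtopology (topo M) (g ` V)) g) \<and>
     (\<Union>(V, g)\<in>atlas M. g ` V) = points M \<and>
     (\<forall>(V, g)\<in>atlas M. \<forall>(W, h)\<in>atlas M.
        smooth_on (V \<inter> g -` (h ` W)) (\<lambda>x. inv_into W h (g x)))"

definition smooth_map :: "('a, 'n::finite) submfd \<Rightarrow> ('a \<Rightarrow> 'b::real_normed_vector) \<Rightarrow> bool" where
  "smooth_map M f \<longleftrightarrow> (\<forall>(V, g)\<in>atlas M. smooth_on V (f \<circ> g))"

text \<open>Tangent vectors of \<open>M\<close> are identified with their images under the differential of \<open>pos M\<close>.\<close>

definition tangent_space :: "('a, 'n::finite) submfd \<Rightarrow> 'a \<Rightarrow> 'n mink set" where
  "tangent_space M p =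
     {w. \<exists>(V, g)\<in>atlas M. \<exists>x\<in>V. g x = p \<and> w \<in> range (frechet_derivative (pos M \<circ> g) (at x))}"

text \<open>A submanifold is the image of an immersion \<open>pos M\<close>, the position vector, which need not be
  injective; it is Riemannian if the induced metric is positive definite.\<close>

definition riemannian_submanifold :: "('a, 'n::finite) submfd \<Rightarrow> bool" where
  "riemannian_submanifold M \<longleftrightarrow>
     smooth_manifold M \<and> smooth_map M (pos M) \<and>
     (\<forall>(V, g)\<in>atlas M. \<forall>x\<in>V. inj (frechet_derivative (pos M \<circ> g) (at x))) \<and>
     (\<forall>p\<in>points M. \<forall>w\<in>tangent_space M p. w \<noteq> 0 \<longrightarrow> lorentz w w > 0)"

definition normal_space :: "('a, 'n::finite) submfd \<Rightarrow> 'a \<Rightarrow> 'n mink set" where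
  "normal_space M p = {u. \<forall>w\<in>tangent_space M p. lorentz u w = 0}"

text \<open>The derivative \<open>w(f)\<close> at \<open>p\<close> of a smooth map \<open>f\<close> in the direction of the tangent vector \<open>w\<close>.
  By compatibility of the atlas the value does not depend on the parametrization. For
  \<open>f\<close> with values in Minkowski space, this is the flat connection of the ambient space.\<close>

definition deriv_along ::
  "('a, 'n::finite) submfd \<Rightarrow> ('a \<Rightarrow> 'b::real_normed_vector) \<Rightarrow> 'a \<Rightarrow> 'n mink \<Rightarrow> 'b" where
  "deriv_along M f p w =
     (THE d. \<exists>(V, g)\<in>atlas M. \<exists>x\<in>V. \<exists>v. g x = p \<and>
        frechet_derivative (pos M \<circ> g) (at x) v = w \<and>
        frechet_derivative (f \<circ> g) (at x) v = d)"

definition tangent_field :: "('a, 'n::finite) submfd \<Rightarrow> ('a \<Rightarrow> 'n mink) \<Rightarrow> bool" where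
  "tangent_field M X \<longleftrightarrow> smooth_map M X \<and> (\<forall>p\<in>points M. X p \<in> tangent_space M p)"

definition normal_field :: "('a, 'n::finite) submfd \<Rightarrow> ('a \<Rightarrow> 'n mink) \<Rightarrow> bool" where
  "normal_field M \<zeta> \<longleftrightarrow> smooth_map M \<zeta> \<and> (\<forall>p\<in>points M. \<zeta> p \<in> normal_space M p)"

section \<open>Shape operator, normal connection, normal curvature\<close>

definition tangential_part :: "('a, 'n::finite) submfd \<Rightarrow> 'a \<Rightarrow> 'n mink \<Rightarrow> 'n mink" where
  "tangential_part M p w = orth_proj (tangent_space M p) w"

definition shape_operator ::
  "('a, 'n::finite) submfd \<Rightarrow> ('a \<Rightarrow> 'n mink) \<Rightarrow> 'a \<Rightarrow> 'n mink \<Rightarrow> 'n mink" where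
  "shape_operator M \<zeta> p w = - tangential_part M p (deriv_along M \<zeta> p w)"

definition normal_connection ::
  "('a, 'n::finite) submfd \<Rightarrow> ('a \<Rightarrow> 'n mink) \<Rightarrow> ('a \<Rightarrow> 'n mink) \<Rightarrow> 'a \<Rightarrow> 'n mink" where
  "normal_connection M X \<zeta> p =
     deriv_along M \<zeta> p (X p) - tangential_part M p (deriv_along M \<zeta> p (X p))"

text \<open>Since \<open>Y(pos M) = Y\<close> under the identification of tangent vectors, the bracket
  \<open>[X, Y](pos M) = X(Y(pos M)) - Y(X(pos M))\<close> takes the following form.\<close>

definition lie_bracket ::
  "('a, 'n::finite) submfd \<Rightarrow> ('a \<Rightarrow> 'n mink) \<Rightarrow> ('a \<Rightarrow> 'n mink) \<Rightarrow> 'a \<Rightarrow> 'n mink" where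
  "lie_bracket M X Y p = deriv_along M Y p (X p) - deriv_along M X p (Y p)"

definition normal_curvature ::
  "('a, 'n::finite) submfd \<Rightarrow> ('a \<Rightarrow> 'n mink) \<Rightarrow> ('a \<Rightarrow> 'n mink) \<Rightarrow> ('a \<Rightarrow> 'n mink) \<Rightarrow> 'a \<Rightarrow> 'n mink"
  where
  "normal_curvature M X Y \<zeta> p =
     normal_connection M X (normal_connection M Y \<zeta>) p
     - normal_connection M Y (normal_connection M X \<zeta>) p
     - normal_connection M (lie_bracket M X Y) \<zeta> p"

definition flat_normal_bundle :: "('a, 'n::finite) submfd \<Rightarrow> bool" where
  "flat_normal_bundle M \<longleftrightarrow>
     (\<forall>X Y \<zeta>. tangent_field M X \<longrightarrow> tangent_field M Y \<longrightarrow> normal_field M \<zeta> \<longrightarrow>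
        (\<forall>p\<in>points M. normal_curvature M X Y \<zeta> p = 0))"

section \<open>The adapted frame on the cylinder over the light cone\<close>

definition theta :: "('a, 'n::finite) submfd \<Rightarrow> 'a \<Rightarrow> 'n mink" where
  "theta M p = (case pos M p of (t, y, s) \<Rightarrow> (t, y, 0))"

definition e1_field :: "('a, 'n::finite) submfd \<Rightarrow> 'a \<Rightarrow> 'n mink" where
  "e1_field M p = tangential_part M p axis_last"

definition Dperp :: "('a, 'n::finite) submfd \<Rightarrow> 'a \<Rightarrow> 'n mink set" where
  "Dperp M p = {w \<in> tangent_space M p. lorentz w (e1_field M p) = 0}"

text \<open>The operator \<open>\<Pi> \<circ> A\<^sub>\<xi>\<close> is used on \<open>Dperp M p\<close> only.\<close>

definition L_operator ::
  "('a, 'n::finite) submfd \<Rightarrow> ('a \<Rightarrow> 'n mink) \<Rightarrow> 'a \<Rightarrow> 'n mink \<Rightarrow> 'n mink" where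
  "L_operator M \<xi> p w = orth_proj (Dperp M p) (shape_operator M \<xi> p w)"

text \<open>The frame vectors \<open>e\<^sub>2, \<dots>, e\<^sub>n\<close> are only required to form a frame at each point; they may
  depend on the point in a discontinuous way, so that such a frame exists on all of \<open>M\<close>.\<close>

definition adapted_frame ::
  "('a, 'n::finite) submfd \<Rightarrow> (nat \<Rightarrow> 'a \<Rightarrow> 'n mink) \<Rightarrow> ('a \<Rightarrow> 'n mink) \<Rightarrow> ('a \<Rightarrow> real) \<Rightarrow> bool" where
  "adapted_frame M e \<xi> \<alpha> \<longleftrightarrow>
     normal_field M \<xi> \<and>
     (\<forall>p\<in>points M. lorentz (\<xi> p) (\<xi> p) = 0 \<and> lorentz (\<xi> p) (theta M p) = - 1) \<and>
     (\<forall>p\<in>points M. e 1 p = e1_field M p) \<and>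
     smooth_map M \<alpha> \<and>
     (\<forall>p\<in>points M. normal_connection M (e 1) (theta M) p = \<alpha> p *\<^sub>R theta M p) \<and>
     (\<forall>p\<in>points M.
        span ((\<lambda>a. e a p) ` {2..CARD('n)}) = Dperp M p \<and>
        (\<forall>a\<in>{2..CARD('n)}. \<forall>b\<in>{2..CARD('n)}.
           lorentz (e a p) (e b p) = (if a = b then 1 else 0)) \<and>
        (\<forall>a\<in>{2..CARD('n)}. \<exists>\<kappa>. L_operator M \<xi> p (e a p) = \<kappa> *\<^sub>R e a p))"

end

theory Submission
  imports Defs
begin

text \<open>The normal bundle has the global null frame \<open>\<theta>\<close>, \<open>\<xi>\<close>. Differentiating \<open>lorentz \<theta> \<theta> = 0\<close>,
  \<open>lorentz \<xi> \<xi> = 0\<close> and \<open>lorentz \<xi> \<theta> = - 1\<close> shows that the normal connection acts on it by a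
  single one-form: \<open>\<nabla>\<theta> = \<omega> \<theta>\<close> and \<open>\<nabla>\<xi> = - \<omega> \<xi>\<close>. Let \<open>s\<close> be the last coordinate. Since \<open>\<theta>\<close> is
  the position vector with its last coordinate deleted, its derivative along \<open>w\<close> is
  \<open>w - ds(w) \<partial>\<^sub>s\<close>, and as \<open>\<partial>\<^sub>s = e\<^sub>1 - \<alpha> \<theta>\<close> this gives \<open>\<omega> = \<alpha> ds\<close>
  (\<open>normal_connection_eq\<close>).

  The normal curvature is therefore \<open>d\<omega> = d\<alpha> \<and> ds\<close>, acting with opposite signs on \<open>\<theta>\<close> and \<open>\<xi>\<close>
  (\<open>normal_curvature_eq\<close>). On tangent vectors \<open>ds\<close> is the product with the unit vector \<open>e\<^sub>1\<close>, so
  the two-form vanishes if and only if \<open>d\<alpha>\<close> vanishes on the orthogonal complement \<open>Dperp\<close> of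
  \<open>e\<^sub>1\<close> (\<open>flat_normal_bundle_iff\<close>), and this complement is spanned by \<open>e\<^sub>2, \<dots>, e\<^sub>n\<close>.

  The analysis behind this is the identity \<open>X(Y(f)) - Y(X(f)) = [X, Y](f)\<close> for derivatives along
  tangent fields that are given as maps into Minkowski space (\<open>deriv_along_commutator\<close>). It rests
  on the symmetry of second derivatives (\<open>symmetric_second_derivative\<close>) and on the
  differentiability of the coordinates of a tangent field in a chart
  (\<open>differentiable_coordinates\<close>).\<close>

section \<open>Calculus of smooth maps\<close>

lemma Ck_on_Suc_imp: "Ck_on (Suc k) S f \<Longrightarrow> Ck_on k S f"
proof (induction k arbitrary: f)
  case 0
  then show ?case
    by (auto intro!: continuous_at_imp_continuous_on differentiable_imp_continuous_within)
next
  case (Suc k)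
  then show ?case by simp
qed

lemma differentiable_transform_open:
  assumes "open S" "x \<in> S" "f differentiable (at x)" "\<And>y. y \<in> S \<Longrightarrow> f y = g y"
  shows "g differentiable (at x)"
  using assms has_derivative_transform_within_open unfolding differentiable_def by blast

lemma differentiable_bilinear:
  assumes "bounded_bilinear B" "f differentiable (at x)" "g differentiable (at x)"
  shows "(\<lambda>y. B (f y) (g y)) differentiable (at x)"
  using assms(2,3) bounded_bilinear.FDERIV[OF assms(1)] unfolding differentiable_def by blast

lemma Ck_on_cong:
  assumes "open S" "\<And>x. x \<in> S \<Longrightarrow> f x = g x" "Ck_on k S f"
  shows "Ck_on k S g"
  using assms(2,3)
proof (induction k arbitrary: f g)
  case 0
  then show ?case
    by (metis Ck_on.simps(1) continuous_on_cong)
next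
  case (Suc k)
  have d: "f differentiable at x" if "x \<in> S" for x
    using Suc.prems(2) that by simp
  have "g differentiable at x" if "x \<in> S" for x
    using differentiable_transform_open[OF \<open>open S\<close> that d[OF that]] Suc.prems(1) by blast
  moreover have "frechet_derivative f (at x) v = frechet_derivative g (at x) v" if "x \<in> S" for x v
    using frechet_derivative_transform_within_open[OF d[OF that] \<open>open S\<close> that Suc.prems(1)]
    by simp
  then have "Ck_on k S (\<lambda>x. frechet_derivative g (at x) v)" for v
    using Suc.IH[of "\<lambda>x. frechet_derivative f (at x) v"] Suc.prems(2) by simp
  ultimately show ?case by simp
qed

lemma Ck_on_const: "Ck_on k S (\<lambda>x. c)"
  by (induction k arbitrary: c) simp_all

lemma Ck_on_add:
  assumes "open S" "Ck_on k S f" "Ck_on k S g"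
  shows "Ck_on k S (\<lambda>x. f x + g x)"
  using assms(2,3)
proof (induction k arbitrary: f g)
  case (Suc k)
  have "Ck_on k S (\<lambda>x. frechet_derivative (\<lambda>y. f y + g y) (at x) v)" for v
  proof (rule Ck_on_cong[OF \<open>open S\<close>])
    show "Ck_on k S (\<lambda>x. frechet_derivative f (at x) v + frechet_derivative g (at x) v)"
      using Suc by simp
    show "frechet_derivative f (at x) v + frechet_derivative g (at x) v
        = frechet_derivative (\<lambda>y. f y + g y) (at x) v" if "x \<in> S" for x
      using Suc.prems that
      by (intro fun_cong[OF frechet_derivative_at] has_derivative_add)
         (simp_all add: frechet_derivative_works[symmetric])
  qed
  then show ?case using Suc.prems by simp
qed (auto intro: continuous_on_add)

lemma Ck_on_linear:
  assumes "open S" "bounded_linear L" "Ck_on k S f"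
  shows "Ck_on k S (\<lambda>x. L (f x))"
  using assms(3)
proof (induction k arbitrary: f)
  case (Suc k)
  have d: "((\<lambda>y. L (f y)) has_derivative (\<lambda>v. L (frechet_derivative f (at x) v))) (at x)"
    if "x \<in> S" for x
    using Suc.prems that
    by (intro bounded_linear.has_derivative[OF assms(2)])
       (simp add: frechet_derivative_works[symmetric])
  have "Ck_on k S (\<lambda>x. frechet_derivative (\<lambda>y. L (f y)) (at x) v)" for v
  proof (rule Ck_on_cong[OF \<open>open S\<close>])
    show "Ck_on k S (\<lambda>x. L (frechet_derivative f (at x) v))"
      using Suc by simp
    show "L (frechet_derivative f (at x) v) = frechet_derivative (\<lambda>y. L (f y)) (at x) v"
      if "x \<in> S" for x
      using fun_cong[OF frechet_derivative_at[OF d[OF that]]] .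
  qed
  then show ?case using d by (auto simp: differentiable_def)
qed (auto intro: bounded_linear.continuous_on[OF assms(2)])

lemma Ck_on_bilinear:
  assumes "open S" "bounded_bilinear B" "Ck_on k S f" "Ck_on k S g"
  shows "Ck_on k S (\<lambda>x. B (f x) (g x))"
  using assms(3,4)
proof (induction k arbitrary: f g)
  case (Suc k)
  have d: "((\<lambda>y. B (f y) (g y)) has_derivative
      (\<lambda>v. B (f x) (frechet_derivative g (at x) v) + B (frechet_derivative f (at x) v) (g x))) (at x)"
    if "x \<in> S" for x
    using Suc.prems that
    by (intro bounded_bilinear.FDERIV[OF assms(2)])
       (simp_all add: frechet_derivative_works[symmetric])
  have "Ck_on k S (\<lambda>x. frechet_derivative (\<lambda>y. B (f y) (g y)) (at x) v)" for v
  proof (rule Ck_on_cong[OF \<open>open S\<close>])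
    show "Ck_on k S (\<lambda>x. B (f x) (frechet_derivative g (at x) v)
        + B (frechet_derivative f (at x) v) (g x))"
      using Suc.prems Suc.prems[THEN Ck_on_Suc_imp]
      by (intro Ck_on_add[OF \<open>open S\<close>] Suc.IH) (simp_all only: Ck_on.simps(2))
    show "B (f x) (frechet_derivative g (at x) v) + B (frechet_derivative f (at x) v) (g x)
        = frechet_derivative (\<lambda>y. B (f y) (g y)) (at x) v"
      if "x \<in> S" for x
      using fun_cong[OF frechet_derivative_at[OF d[OF that]]] .
  qed
  then show ?case using d by (auto simp: differentiable_def)
qed (auto intro: bounded_bilinear.continuous_on[OF assms(2)])

section \<open>Symmetry of second derivatives\<close>

text \<open>The mean value theorem is used first in the direction \<open>u\<close>, for the function
  \<open>s \<mapsto> f (x + s u + h v) - f (x + s u)\<close>, and then in the direction \<open>v\<close> for the derivative so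
  obtained. The second difference on the left is symmetric in \<open>u\<close> and \<open>v\<close>, while the right hand
  side is not; the next lemma exploits this.\<close>

lemma second_difference_mean_value:
  fixes f :: "'a::real_normed_vector \<Rightarrow> real"
  assumes "0 < h"
    and S: "\<And>s t. \<lbrakk>0 \<le> s; s \<le> h; 0 \<le> t; t \<le> h\<rbrakk> \<Longrightarrow> x + s *\<^sub>R u + t *\<^sub>R v \<in> S"
    and f: "\<And>y. y \<in> S \<Longrightarrow> (f has_derivative f' y) (at y)"
    and u: "\<And>y. y \<in> S \<Longrightarrow> ((\<lambda>z. f' z u) has_derivative fu y) (at y)"
  shows "\<exists>s t. 0 < s \<and> s < h \<and> 0 < t \<and> t < h \<and>
    f (x + h *\<^sub>R u + h *\<^sub>R v) - f (x + h *\<^sub>R u) - f (x + h *\<^sub>R v) + f x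
      = h * h * fu (x + s *\<^sub>R u + t *\<^sub>R v) v"
proof -
  define \<phi> where "\<phi> s = f (x + s *\<^sub>R u + h *\<^sub>R v) - f (x + s *\<^sub>R u)" for s
  define \<phi>' where "\<phi>' s r = f' (x + s *\<^sub>R u + h *\<^sub>R v) (r *\<^sub>R u) - f' (x + s *\<^sub>R u) (r *\<^sub>R u)" for s r
  have fin: "x + s *\<^sub>R u + h *\<^sub>R v \<in> S" "x + s *\<^sub>R u \<in> S" if "0 \<le> s" "s \<le> h" for s
    using S[of s h] S[of s 0] that \<open>0 < h\<close> by auto
  have "(\<phi> has_derivative \<phi>' s) (at s within {0..h})" if "0 \<le> s" "s \<le> h" for s
    unfolding \<phi>_def \<phi>'_def
    by (rule has_derivative_at_withinI, rule has_derivative_diff)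
       (rule has_derivative_compose[where f = "\<lambda>s. x + s *\<^sub>R u + h *\<^sub>R v" and g = f, OF _ f[OF fin(1)[OF that]]],
        (auto intro!: derivative_eq_intros)[1],
        rule has_derivative_compose[where f = "\<lambda>s. x + s *\<^sub>R u" and g = f, OF _ f[OF fin(2)[OF that]]],
        (auto intro!: derivative_eq_intros)[1])
  then obtain s where s: "s \<in> {0<..<h}" "\<phi> h - \<phi> 0 = \<phi>' s (h - 0)"
    using mvt_simple[OF \<open>0 < h\<close>, of \<phi> \<phi>'] by blast
  have lin: "f' y (r *\<^sub>R u) = r * f' y u" if "y \<in> S" for y r
    using linear_scale[OF has_derivative_linear[OF f[OF that]]] by simp
  define \<psi> where "\<psi> t = f' (x + s *\<^sub>R u + t *\<^sub>R v) u" for t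
  have gin: "x + s *\<^sub>R u + t *\<^sub>R v \<in> S" if "0 \<le> t" "t \<le> h" for t
    using S[of s t] that s by auto
  have "(\<psi> has_derivative (\<lambda>r. fu (x + s *\<^sub>R u + t *\<^sub>R v) (r *\<^sub>R v))) (at t within {0..h})"
    if "0 \<le> t" "t \<le> h" for t
    unfolding \<psi>_def
    by (rule has_derivative_at_withinI, rule has_derivative_compose[where f = "\<lambda>t. x + s *\<^sub>R u + t *\<^sub>R v" and g = "\<lambda>z. f' z u", OF _ u[OF gin[OF that]]])
       (auto intro!: derivative_eq_intros)
  then obtain t where t: "t \<in> {0<..<h}"
      "\<psi> h - \<psi> 0 = fu (x + s *\<^sub>R u + t *\<^sub>R v) ((h - 0) *\<^sub>R v)"
    using mvt_simple[OF \<open>0 < h\<close>, of \<psi> "\<lambda>t r. fu (x + s *\<^sub>R u + t *\<^sub>R v) (r *\<^sub>R v)"] by blast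
  have "fu (x + s *\<^sub>R u + t *\<^sub>R v) (h *\<^sub>R v) = h * fu (x + s *\<^sub>R u + t *\<^sub>R v) v"
    using linear_scale[OF has_derivative_linear[OF u[OF gin]], of t h v] t(1) by auto
  moreover have "\<phi>' s h = h * (\<psi> h - \<psi> 0)"
    unfolding \<phi>'_def \<psi>_def using lin fin[of s] s(1) by (simp add: algebra_simps)
  ultimately have "\<phi> h - \<phi> 0 = h * h * fu (x + s *\<^sub>R u + t *\<^sub>R v) v"
    using s(2) t(2) by simp
  moreover have "f (x + h *\<^sub>R u + h *\<^sub>R v) - f (x + h *\<^sub>R u) - f (x + h *\<^sub>R v) + f x = \<phi> h - \<phi> 0"
    by (simp add: \<phi>_def)
  ultimately show ?thesis
    using s(1) t(1) by auto
qed

text \<open>Both iterated derivatives are limits, as \<open>h\<close> tends to \<open>0\<close>, of one and the same second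
  difference divided by \<open>h * h\<close>. If they differed by \<open>2 * \<epsilon>\<close>, then for small \<open>h\<close> the two mean
  values, each within \<open>\<epsilon>\<close> of its limit, could not agree.\<close>

lemma symmetric_second_derivative_real:
  fixes f :: "'a::real_normed_vector \<Rightarrow> real"
  assumes "open S" "x \<in> S"
    and f: "\<And>y. y \<in> S \<Longrightarrow> (f has_derivative f' y) (at y)"
    and u: "\<And>y. y \<in> S \<Longrightarrow> ((\<lambda>z. f' z u) has_derivative fu y) (at y)"
    and v: "\<And>y. y \<in> S \<Longrightarrow> ((\<lambda>z. f' z v) has_derivative fv y) (at y)"
    and cu: "continuous_on S (\<lambda>y. fu y v)" and cv: "continuous_on S (\<lambda>y. fv y u)"
  shows "fu x v = fv x u"
proof (rule ccontr)
  assume "fu x v \<noteq> fv x u"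
  define \<epsilon> where "\<epsilon> = dist (fu x v) (fv x u) / 2"
  have "\<epsilon> > 0" using \<open>fu x v \<noteq> fv x u\<close> by (simp add: \<epsilon>_def)
  have "isCont (\<lambda>y. fu y v) x" "isCont (\<lambda>y. fv y u) x"
    using cu cv assms(1,2) continuous_on_eq_continuous_at by blast+
  then obtain d1 d2 where d: "d1 > 0" "\<And>y. dist y x < d1 \<Longrightarrow> dist (fu y v) (fu x v) < \<epsilon>"
      "d2 > 0" "\<And>y. dist y x < d2 \<Longrightarrow> dist (fv y u) (fv x u) < \<epsilon>"
    using \<open>\<epsilon> > 0\<close> unfolding continuous_at_eps_delta by metis
  obtain d3 where d3: "d3 > 0" "ball x d3 \<subseteq> S"
    using assms(1,2) openE by blast
  define d where "d = min d1 (min d2 d3)"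
  have "d > 0" using d(1,3) d3(1) by (simp add: d_def)
  \<comment> \<open>The step \<open>h\<close> is small enough for the parallelogram spanned by \<open>h u\<close>
      and \<open>h v\<close> to lie in the ball of radius \<open>d\<close>.\<close>
  define h where "h = d / (norm u + norm v + 1)"
  have "h > 0" using \<open>d > 0\<close> by (simp add: h_def add_nonneg_pos)
  have near: "dist (x + s *\<^sub>R u + t *\<^sub>R v) x < d" if "0 \<le> s" "s \<le> h" "0 \<le> t" "t \<le> h" for s t
  proof -
    have "dist (x + s *\<^sub>R u + t *\<^sub>R v) x = norm (s *\<^sub>R u + t *\<^sub>R v)"
      by (simp add: dist_norm add.assoc)
    also have "\<dots> \<le> s * norm u + t * norm v"
      using norm_triangle_ineq[of "s *\<^sub>R u" "t *\<^sub>R v"] that by simp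
    also have "\<dots> \<le> h * norm u + h * norm v"
      using that by (intro add_mono mult_right_mono) auto
    also have "\<dots> < h * (norm u + norm v + 1)"
      using \<open>h > 0\<close> by (simp add: algebra_simps)
    also have "\<dots> = d"
      using add_nonneg_pos[OF add_nonneg_nonneg[OF norm_ge_zero[of u] norm_ge_zero[of v]] zero_less_one]
      by (simp add: h_def)
    finally show ?thesis .
  qed
  have inS: "x + s *\<^sub>R u + t *\<^sub>R v \<in> S" if "0 \<le> s" "s \<le> h" "0 \<le> t" "t \<le> h" for s t
    using near[OF that] d3(2) by (auto simp: d_def dist_commute mem_ball)
  have inS': "x + s *\<^sub>R v + t *\<^sub>R u \<in> S" if "0 \<le> s" "s \<le> h" "0 \<le> t" "t \<le> h" for s t
    using inS[OF that(3,4,1,2)] by (simp add: algebra_simps)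
  define \<Delta> where "\<Delta> = f (x + h *\<^sub>R u + h *\<^sub>R v) - f (x + h *\<^sub>R u) - f (x + h *\<^sub>R v) + f x"
  obtain s t where st: "0 < s" "s < h" "0 < t" "t < h"
      "\<Delta> = h * h * fu (x + s *\<^sub>R u + t *\<^sub>R v) v"
    using second_difference_mean_value[OF \<open>h > 0\<close> inS f u] unfolding \<Delta>_def by blast
  obtain s' t' where st': "0 < s'" "s' < h" "0 < t'" "t' < h"
      "f (x + h *\<^sub>R v + h *\<^sub>R u) - f (x + h *\<^sub>R v) - f (x + h *\<^sub>R u) + f x
        = h * h * fv (x + s' *\<^sub>R v + t' *\<^sub>R u) u"
    using second_difference_mean_value[OF \<open>h > 0\<close> inS' f v] by blast
  have "f (x + h *\<^sub>R v + h *\<^sub>R u) - f (x + h *\<^sub>R v) - f (x + h *\<^sub>R u) + f x = \<Delta>"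
    by (simp add: \<Delta>_def add.assoc add.commute[of "h *\<^sub>R v"])
  with st(5) st'(5) \<open>h > 0\<close>
  have eq: "fu (x + s *\<^sub>R u + t *\<^sub>R v) v = fv (x + t' *\<^sub>R u + s' *\<^sub>R v) u"
    by (simp add: algebra_simps)
  have "dist (fu (x + s *\<^sub>R u + t *\<^sub>R v) v) (fu x v) < \<epsilon>"
    using st near[of s t] by (intro d) (simp add: d_def)
  moreover have "dist (fv (x + t' *\<^sub>R u + s' *\<^sub>R v) u) (fv x u) < \<epsilon>"
    using st' near[of t' s'] by (intro d) (simp add: d_def)
  ultimately have "dist (fu x v) (fv x u) < \<epsilon> + \<epsilon>"
    unfolding eq by (metis dist_commute dist_triangle_less_add)
  then show False by (simp add: \<epsilon>_def)
qed

lemma symmetric_second_derivative: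
  fixes f :: "'a::real_normed_vector \<Rightarrow> 'b::real_inner"
  assumes "open S" "x \<in> S" "Ck_on 2 S f"
  shows "frechet_derivative (\<lambda>y. frechet_derivative f (at y) u) (at x) v
    = frechet_derivative (\<lambda>y. frechet_derivative f (at y) v) (at x) u"
proof -
  define H where "H a y b = frechet_derivative (\<lambda>y. frechet_derivative f (at y) a) (at y) b" for a y b
  have f: "(f has_derivative frechet_derivative f (at y)) (at y)" if "y \<in> S" for y
    using assms(3) that by (simp add: numeral_2_eq_2 frechet_derivative_works[symmetric])
  have f2: "((\<lambda>z. frechet_derivative f (at z) a) has_derivative H a y) (at y)"
    if "y \<in> S" for a y
    using assms(3) that
    by (simp add: numeral_2_eq_2 H_def[abs_def] frechet_derivative_works[symmetric])
  have c: "continuous_on S (\<lambda>y. H a y b)" for a b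
    using assms(3) by (simp add: numeral_2_eq_2 H_def)
  \<comment> \<open>Testing against the difference itself reduces the claim to a real function.\<close>
  define d where "d = H u x v - H v x u"
  have "H u x v \<bullet> d = H v x u \<bullet> d"
    by (rule symmetric_second_derivative_real[OF assms(1,2),
          where f = "\<lambda>y. f y \<bullet> d" and f' = "\<lambda>y a. frechet_derivative f (at y) a \<bullet> d"
            and fu = "\<lambda>y b. H u y b \<bullet> d" and fv = "\<lambda>y b. H v y b \<bullet> d"])
       (auto intro!: has_derivative_inner_left f f2 continuous_on_inner c continuous_intros)
  then have "d \<bullet> d = 0"
    by (simp add: d_def inner_diff_left)
  then show ?thesis by (simp add: d_def H_def)
qed

text \<open>The product rule for \<open>df(v)\<close> with a variable direction \<open>v\<close>. By symmetry of the Hessian the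
  second term may be written with \<open>a\<close> and \<open>v x\<close> exchanged. In this form, for two directions \<open>u\<close> and
  \<open>v\<close>, the Hessian terms of \<open>u(v(f))\<close> and \<open>v(u(f))\<close> cancel and only
  \<open>df(v'(u) - u'(v))\<close> remains.\<close>

lemma has_derivative_frechet_derivative_apply:
  fixes f :: "'a::euclidean_space \<Rightarrow> 'b::real_inner"
  assumes "open S" "x \<in> S" "Ck_on 2 S f" and v: "(v has_derivative v') (at x)"
  shows "((\<lambda>y. frechet_derivative f (at y) (v y)) has_derivative
    (\<lambda>a. frechet_derivative f (at x) (v' a)
       + frechet_derivative (\<lambda>y. frechet_derivative f (at y) a) (at x) (v x))) (at x)"
proof -
  define H where "H a b = frechet_derivative (\<lambda>y. frechet_derivative f (at y) a) (at x) b" for a b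
  have lin: "linear (frechet_derivative f (at y))" if "y \<in> S" for y
    using assms(3) that by (intro linear_frechet_derivative) (simp add: numeral_2_eq_2)
  have expand: "frechet_derivative f (at y) w = (\<Sum>i\<in>Basis. (w \<bullet> i) *\<^sub>R frechet_derivative f (at y) i)"
    if "y \<in> S" for y w
    using Real_Vector_Spaces.linear_sum[OF lin[OF that], of "\<lambda>i. (w \<bullet> i) *\<^sub>R i" Basis]
    by (simp add: euclidean_representation linear_scale[OF lin[OF that]])
  have f2: "((\<lambda>z. frechet_derivative f (at z) a) has_derivative H a) (at x)" for a
    using assms(2,3)
    by (simp add: numeral_2_eq_2 H_def[abs_def] frechet_derivative_works[symmetric])
  have linH: "linear (H a)" for a
    using f2 has_derivative_linear by blast
  have "((\<lambda>y. \<Sum>i\<in>Basis. (v y \<bullet> i) *\<^sub>R frechet_derivative f (at y) i) has_derivative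
      (\<lambda>a. \<Sum>i\<in>Basis. (v x \<bullet> i) *\<^sub>R H i a + (v' a \<bullet> i) *\<^sub>R frechet_derivative f (at x) i)) (at x)"
    by (intro has_derivative_sum has_derivative_scaleR has_derivative_inner_left v f2)
  moreover have "(\<Sum>i\<in>Basis. (v x \<bullet> i) *\<^sub>R H i a + (v' a \<bullet> i) *\<^sub>R frechet_derivative f (at x) i)
      = frechet_derivative f (at x) (v' a) + H a (v x)" for a
  proof -
    have "(\<Sum>i\<in>Basis. (v x \<bullet> i) *\<^sub>R H i a) = (\<Sum>i\<in>Basis. (v x \<bullet> i) *\<^sub>R H a i)"
      using symmetric_second_derivative[OF assms(1,2,3)] by (simp add: H_def)
    also have "\<dots> = H a (v x)"
      using Real_Vector_Spaces.linear_sum[OF linH, of a "\<lambda>i. (v x \<bullet> i) *\<^sub>R i" Basis]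
      by (simp add: euclidean_representation linear_scale[OF linH])
    finally show ?thesis
      by (simp add: sum.distrib expand[OF assms(2), of "v' a"] add.commute)
  qed
  ultimately have "((\<lambda>y. \<Sum>i\<in>Basis. (v y \<bullet> i) *\<^sub>R frechet_derivative f (at y) i) has_derivative
      (\<lambda>a. frechet_derivative f (at x) (v' a) + H a (v x))) (at x)"
    by simp
  then show ?thesis
    unfolding H_def
    by (rule has_derivative_transform_within_open[OF _ assms(1,2)]) (rule expand[symmetric])
qed

section \<open>The Lorentz product\<close>

lemma bounded_bilinear_lorentz:
  "bounded_bilinear (lorentz :: 'n::finite mink \<Rightarrow> 'n mink \<Rightarrow> real)"
proof -
  define J :: "'n mink \<Rightarrow> 'n mink" where "J u = (- fst u, snd u)" for u
  have J: "bounded_linear J"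
    unfolding J_def
    by (intro bounded_linear_Pair bounded_linear_minus bounded_linear_fst bounded_linear_snd)
  have "lorentz u v = u \<bullet> J v" for u v :: "'n mink"
    by (cases u; cases v) (auto simp: lorentz_def J_def inner_prod_def)
  then show ?thesis
    using bounded_bilinear.comp[OF bounded_bilinear_inner bounded_linear_ident J] by presburger
qed

interpretation lorentz: bounded_bilinear lorentz
  by (rule bounded_bilinear_lorentz)

lemma lorentz_commute: "lorentz u v = lorentz v u"
  by (auto simp: lorentz_def inner_commute split: prod.split)

lemma differentiable_det:
  fixes A :: "'a::real_normed_vector \<Rightarrow> real ^ 'n ^ 'n"
  assumes "\<And>i j. (\<lambda>y. A y $ i $ j) differentiable (at x)"
  shows "(\<lambda>y. det (A y)) differentiable (at x)"
proof -
  have "(\<lambda>y. \<Prod>i\<in>UNIV. A y $ i $ p i) differentiable (at x)" for p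
  proof -
    obtain D where "\<And>i j. ((\<lambda>y. A y $ i $ j) has_derivative D i j) (at x)"
      using assms unfolding differentiable_def by metis
    then show ?thesis
      using has_derivative_prod[of UNIV "\<lambda>i y. A y $ i $ p i" "\<lambda>i. D i (p i)" x UNIV]
      unfolding differentiable_def by blast
  qed
  then show ?thesis
    unfolding det_def by (intro differentiable_sum differentiable_mult differentiable_const) auto
qed

text \<open>The coordinates \<open>u\<close> of a tangent field \<open>w\<close> in the basis \<open>G (axis i 1)\<close> solve the linear system
  whose matrix is the Gram matrix of that basis, that is, the first fundamental form. It is
  invertible because the induced metric is definite, and Cramer's rule then expresses \<open>u\<close>
  rationally in differentiable functions.\<close>

lemma differentiable_coordinates:
  fixes G :: "'a::real_normed_vector \<Rightarrow> real ^ 'n \<Rightarrow> 'n mink"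
  assumes "open V" "x \<in> V"
    and lin: "\<And>y. y \<in> V \<Longrightarrow> linear (G y)"
    and inj: "\<And>y. y \<in> V \<Longrightarrow> inj (G y)"
    and pos: "\<And>y a. y \<in> V \<Longrightarrow> G y a \<noteq> 0 \<Longrightarrow> lorentz (G y a) (G y a) > 0"
    and G: "\<And>a. (\<lambda>y. G y a) differentiable (at x)"
    and w: "w differentiable (at x)"
    and u: "\<And>y. y \<in> V \<Longrightarrow> G y (u y) = w y"
  shows "u differentiable (at x)"
proof -
  define A :: "'a \<Rightarrow> real ^ 'n ^ 'n"
    where "A y = (\<chi> i j. lorentz (G y (axis i 1)) (G y (axis j 1)))" for y
  define b where "b y = (\<chi> i. lorentz (G y (axis i 1)) (w y))" for y
  have expand: "G y a = (\<Sum>j\<in>UNIV. (a $ j) *\<^sub>R G y (axis j 1))" if "y \<in> V" for y a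
  proof -
    have "G y a = G y (\<Sum>j\<in>UNIV. (a $ j) *\<^sub>R axis j 1)"
      by (simp add: basis_expansion flip: scalar_mult_eq_scaleR)
    then show ?thesis
      using lin[OF that] by (simp add: linear_sum linear_scale)
  qed
  have gram: "(A y *v a) $ i = lorentz (G y (axis i 1)) (G y a)" if "y \<in> V" for y a i
    by (subst (2) expand[OF that])
       (simp add: A_def matrix_vector_mult_def lorentz.sum_right lorentz.scaleR_right mult.commute)
  have det: "det (A y) \<noteq> 0" if "y \<in> V" for y
  proof -
    have "a = 0" if "A y *v a = 0" for a
    proof -
      have "lorentz (G y (axis i 1)) (G y a) = 0" for i
        using gram[OF \<open>y \<in> V\<close>, of a i] that by simp
      then have "lorentz (G y a) (G y a) = 0"
        by (subst (1) expand[OF \<open>y \<in> V\<close>]) (simp add: lorentz.sum_left lorentz.scaleR_left)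
      then have "G y a = 0"
        using pos[OF \<open>y \<in> V\<close>, of a] by fastforce
      then show "a = 0"
        using inj[OF \<open>y \<in> V\<close>] lin[OF \<open>y \<in> V\<close>] by (metis injD linear_0)
    qed
    then show ?thesis
      by (simp add: invertible_det_nz[symmetric] invertible_left_inverse matrix_left_invertible_ker)
  qed
  have "A y *v u y = b y" if "y \<in> V" for y
    by (simp add: vec_eq_iff gram[OF that] u[OF that] b_def)
  then have cram: "u y = (\<chi> k. det (\<chi> i j. if j = k then b y $ i else A y $ i $ j) / det (A y))"
    if "y \<in> V" for y
    using cramer[OF det[OF that]] that by blast
  have dA: "(\<lambda>y. A y $ i $ j) differentiable (at x)" and db: "(\<lambda>y. b y $ i) differentiable (at x)"
    for i j
    unfolding A_def b_def vec_lambda_beta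
    by (intro differentiable_bilinear[OF bounded_bilinear_lorentz] G w)+
  have comp: "(\<lambda>y. u y $ k) differentiable (at x)" for k
  proof (rule differentiable_transform_open[OF assms(1,2)])
    show "(\<lambda>y. det (\<chi> i j. if j = k then b y $ i else A y $ i $ j) / det (A y))
        differentiable (at x)"
    proof (intro differentiable_divide differentiable_det)
      show "(\<lambda>y. (\<chi> i j. if j = k then b y $ i else A y $ i $ j) $ i $ j) differentiable (at x)"
        for i j
        using dA db by (cases "j = k") simp_all
    qed (use dA det[OF assms(2)] in auto)
    show "det (\<chi> i j. if j = k then b y $ i else A y $ i $ j) / det (A y) = u y $ k"
      if "y \<in> V" for y
      by (subst cram[OF that]) simp
  qed
  have "(\<lambda>y. u y \<bullet> i) differentiable (at x)" if "i \<in> Basis" for i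
    using that comp by (auto simp: Basis_vec_def inner_axis)
  then show ?thesis
    using differentiable_componentwise_within[of u x UNIV] by simp
qed

section \<open>Differentials along a submanifold\<close>

text \<open>Tangent vectors are represented by their images in Minkowski space, so the differential of
  \<open>f\<close> at \<open>p\<close> is a map \<open>D\<close> on these images. As a relation, this notion obeys the usual rules of
  differentiation without any reference to the definite description in \<open>deriv_along\<close>. Only the
  values of \<open>D\<close> on the tangent space matter.\<close>

definition has_differential ::
  "('a, 'n::finite) submfd \<Rightarrow> ('a \<Rightarrow> 'b::real_normed_vector) \<Rightarrow> ('n mink \<Rightarrow> 'b) \<Rightarrow> 'a \<Rightarrow> bool" where
  "has_differential M f D p \<longleftrightarrow> (\<forall>(V, g)\<in>atlas M. \<forall>x\<in>V. g x = p \<longrightarrow>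
     ((f \<circ> g) has_derivative (\<lambda>v. D (frechet_derivative (pos M \<circ> g) (at x) v))) (at x))"

lemma has_differentialI:
  assumes "\<And>V g x. (V, g) \<in> atlas M \<Longrightarrow> x \<in> V \<Longrightarrow> g x = p \<Longrightarrow>
     ((f \<circ> g) has_derivative (\<lambda>v. D (frechet_derivative (pos M \<circ> g) (at x) v))) (at x)"
  shows "has_differential M f D p"
  using assms unfolding has_differential_def by auto

lemma has_differentialD:
  assumes "has_differential M f D p" "(V, g) \<in> atlas M" "x \<in> V" "g x = p"
  shows "((f \<circ> g) has_derivative (\<lambda>v. D (frechet_derivative (pos M \<circ> g) (at x) v))) (at x)"
  using assms unfolding has_differential_def by blast

lemma has_differential_const: "has_differential M (\<lambda>p. c) (\<lambda>w. 0) p"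
  by (rule has_differentialI) (simp add: o_def)

lemma has_differential_add:
  assumes "has_differential M f D p" "has_differential M h E p"
  shows "has_differential M (\<lambda>p. f p + h p) (\<lambda>w. D w + E w) p"
  using has_derivative_add[OF has_differentialD[OF assms(1)] has_differentialD[OF assms(2)]]
  by (intro has_differentialI) (simp add: o_def)

lemma has_differential_linear:
  assumes "bounded_linear L" "has_differential M f D p"
  shows "has_differential M (\<lambda>p. L (f p)) (\<lambda>w. L (D w)) p"
  using bounded_linear.has_derivative[OF assms(1) has_differentialD[OF assms(2)]]
  by (intro has_differentialI) (simp add: o_def)

lemmas has_differential_minus = has_differential_linear[OF bounded_linear_minus[OF bounded_linear_ident]]

lemma has_differential_bilinear:
  assumes "bounded_bilinear B" "has_differential M f D p" "has_differential M h E p"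
  shows "has_differential M (\<lambda>p. B (f p) (h p)) (\<lambda>w. B (f p) (E w) + B (D w) (h p)) p"
  using bounded_bilinear.FDERIV[OF assms(1) has_differentialD[OF assms(2)]
      has_differentialD[OF assms(3)]]
  by (intro has_differentialI) (auto simp add: o_def)

lemmas has_differential_lorentz = has_differential_bilinear[OF bounded_bilinear_lorentz]
lemmas has_differential_scaleR = has_differential_bilinear[OF bounded_bilinear_scaleR]
lemmas has_differential_mult = has_differential_bilinear[OF bounded_bilinear_mult]

text \<open>The definite description is resolved here without transition maps: each chart yields the same value \<open>D w\<close>.\<close>

lemma deriv_along_eq:
  assumes "has_differential M f D p" "w \<in> tangent_space M p"
  shows "deriv_along M f p w = D w"
proof -
  obtain V g x v where c: "(V, g) \<in> atlas M" "x \<in> V" "g x = p"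
      "w = frechet_derivative (pos M \<circ> g) (at x) v"
    using assms(2) unfolding tangent_space_def by auto
  have eq: "frechet_derivative (f \<circ> g) (at x) v = D (frechet_derivative (pos M \<circ> g) (at x) v)"
    if "(V, g) \<in> atlas M" "x \<in> V" "g x = p" for V g x v
    using fun_cong[OF frechet_derivative_at[OF has_differentialD[OF assms(1) that]], of v] by simp
  show ?thesis
    unfolding deriv_along_def
  proof (rule the_equality)
    show "\<exists>(V, g)\<in>atlas M. \<exists>x\<in>V. \<exists>v. g x = p \<and> frechet_derivative (pos M \<circ> g) (at x) v = w
        \<and> frechet_derivative (f \<circ> g) (at x) v = D w"
      using c eq[OF c(1-3)] by blast
    show "d = D w" if "\<exists>(V, g)\<in>atlas M. \<exists>x\<in>V. \<exists>v. g x = p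
        \<and> frechet_derivative (pos M \<circ> g) (at x) v = w \<and> frechet_derivative (f \<circ> g) (at x) v = d" for d
      using that eq by auto
  qed
qed

lemma differential_unique:
  assumes "has_differential M f D p" "has_differential M f E p" "w \<in> tangent_space M p"
  shows "D w = E w"
  using deriv_along_eq[OF assms(1,3)] deriv_along_eq[OF assms(2,3)] by simp

lemma smooth_map_const: "smooth_map M (\<lambda>p. c)"
  unfolding smooth_map_def smooth_on_def by (auto simp: o_def Ck_on_const)

section \<open>Riemannian submanifolds of Minkowski space\<close>

locale riemannian_submfd =
  fixes M :: "('a, 'n::finite) submfd"
  assumes riemannian: "riemannian_submanifold M"
begin

abbreviation dpos :: "(real ^ 'n \<Rightarrow> 'a) \<Rightarrow> real ^ 'n \<Rightarrow> real ^ 'n \<Rightarrow> 'n mink" where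
  "dpos g x \<equiv> frechet_derivative (pos M \<circ> g) (at x)"

lemma manifold: "smooth_manifold M" and smooth_pos: "smooth_map M (pos M)"
  using riemannian unfolding riemannian_submanifold_def by auto

lemma smooth_map_Ck: "smooth_map M f \<Longrightarrow> (V, g) \<in> atlas M \<Longrightarrow> Ck_on k V (f \<circ> g)"
  unfolding smooth_map_def smooth_on_def by blast

lemma smooth_map_differentiable:
  "smooth_map M f \<Longrightarrow> (V, g) \<in> atlas M \<Longrightarrow> x \<in> V \<Longrightarrow> (f \<circ> g) differentiable (at x)"
  using smooth_map_Ck[of f V g "Suc 0"] by simp

lemma
  assumes "(V, g) \<in> atlas M"
  shows open_chart: "open V"
    and chart_openin: "openin (topo M) (g ` V)"
    and chart_homeomorphic: "homeomorphic_map (top_of_set V) (subtopology (topo M) (g ` V)) g"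
    and inj_dpos: "x \<in> V \<Longrightarrow> inj (dpos g x)"
  using assms riemannian unfolding riemannian_submanifold_def smooth_manifold_def by auto

lemma chart_point: "(V, g) \<in> atlas M \<Longrightarrow> x \<in> V \<Longrightarrow> g x \<in> points M"
  using openin_subset[OF chart_openin] by blast

lemma smooth_mapI:
  "(\<And>k V g. (V, g) \<in> atlas M \<Longrightarrow> Ck_on k V (\<lambda>x. f (g x))) \<Longrightarrow> smooth_map M f"
  unfolding smooth_map_def smooth_on_def o_def by blast

lemma smooth_map_cong:
  assumes "smooth_map M f" "\<And>p. p \<in> points M \<Longrightarrow> f p = h p"
  shows "smooth_map M h"
  using Ck_on_cong[OF open_chart _ smooth_map_Ck[OF assms(1)]] assms(2) chart_point
  by (intro smooth_mapI) simp

lemma smooth_map_add: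
  assumes "smooth_map M f" "smooth_map M h"
  shows "smooth_map M (\<lambda>p. f p + h p)"
  using Ck_on_add[OF open_chart smooth_map_Ck[OF assms(1)] smooth_map_Ck[OF assms(2)]]
  by (intro smooth_mapI) (simp add: o_def)

lemma smooth_map_linear:
  assumes "bounded_linear L" "smooth_map M f"
  shows "smooth_map M (\<lambda>p. L (f p))"
  using Ck_on_linear[OF open_chart assms(1) smooth_map_Ck[OF assms(2)]]
  by (intro smooth_mapI) (simp add: o_def)

lemma smooth_map_bilinear:
  assumes "bounded_bilinear B" "smooth_map M f" "smooth_map M h"
  shows "smooth_map M (\<lambda>p. B (f p) (h p))"
  using Ck_on_bilinear[OF open_chart assms(1) smooth_map_Ck[OF assms(2)] smooth_map_Ck[OF assms(3)]]
  by (intro smooth_mapI) (simp add: o_def)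

lemma point_chart:
  assumes "p \<in> points M"
  obtains V g x where "(V, g) \<in> atlas M" "x \<in> V" "g x = p"
proof -
  have "p \<in> (\<Union>(V, g)\<in>atlas M. g ` V)"
    using assms manifold unfolding smooth_manifold_def by simp
  then show ?thesis using that by auto
qed

lemma linear_dpos: "(V, g) \<in> atlas M \<Longrightarrow> x \<in> V \<Longrightarrow> linear (dpos g x)"
  by (intro linear_frechet_derivative smooth_map_differentiable[OF smooth_pos])

lemma dpos_tangent: "(V, g) \<in> atlas M \<Longrightarrow> x \<in> V \<Longrightarrow> dpos g x v \<in> tangent_space M (g x)"
  unfolding tangent_space_def by blast

lemma tangent_pos: "p \<in> points M \<Longrightarrow> w \<in> tangent_space M p \<Longrightarrow> w \<noteq> 0 \<Longrightarrow> lorentz w w > 0"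
  using riemannian unfolding riemannian_submanifold_def by blast

text \<open>The chain rule for a change of charts. The factor coming from the transition map does not depend
  on \<open>f\<close>; applied to both \<open>f\<close> and \<open>pos M\<close>, this is what makes \<open>deriv_along\<close> independent of the chart.\<close>

lemma has_derivative_transition:
  assumes g: "(V, g) \<in> atlas M" "x \<in> V" and h: "(W, h) \<in> atlas M" "y \<in> W" and eq: "g x = h y"
    and f: "(f \<circ> h) differentiable (at y)"
  shows "((f \<circ> g) has_derivative (\<lambda>v. frechet_derivative (f \<circ> h) (at y)
    (frechet_derivative (\<lambda>z. inv_into W h (g z)) (at x) v))) (at x)"
proof -
  define S where "S = V \<inter> g -` (h ` W)"
  define \<psi> where "\<psi> z = inv_into W h (g z)" for z
  have "continuous_map (top_of_set V) (topo M) g"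
    using homeomorphic_imp_continuous_map[OF chart_homeomorphic[OF g(1)]]
    by (simp add: continuous_map_in_subtopology)
  then have "openin (top_of_set V) {z \<in> topspace (top_of_set V). g z \<in> h ` W}"
    by (rule openin_continuous_map_preimage[OF _ chart_openin[OF h(1)]])
  then have "openin (top_of_set V) S"
    by (simp add: S_def Int_def vimage_def)
  then have "open S"
    using open_chart[OF g(1)] openin_open_trans by blast
  have "x \<in> S" using g(2) h(2) eq by (auto simp: S_def)
  have "smooth_on S \<psi>"
    using manifold g(1) h(1) unfolding smooth_manifold_def S_def \<psi>_def[abs_def] by fast
  then have "Ck_on (Suc 0) S \<psi>" unfolding smooth_on_def by blast
  then have "\<psi> differentiable (at x)" using \<open>x \<in> S\<close> by simp
  then have d\<psi>: "(\<psi> has_derivative frechet_derivative \<psi> (at x)) (at x)"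
    by (simp add: frechet_derivative_works)
  have "inj_on h W"
    using homeomorphic_imp_injective_map[OF chart_homeomorphic[OF h(1)]] by simp
  then have "\<psi> x = y" using eq h(2) by (simp add: \<psi>_def)
  then have "((\<lambda>z. (f \<circ> h) (\<psi> z)) has_derivative
      (\<lambda>v. frechet_derivative (f \<circ> h) (at y) (frechet_derivative \<psi> (at x) v))) (at x)"
    using has_derivative_compose[OF d\<psi>, of "f \<circ> h"] f unfolding frechet_derivative_works by metis
  moreover have "(f \<circ> h) (\<psi> z) = (f \<circ> g) z" if "z \<in> S" for z
    using that by (simp add: S_def \<psi>_def f_inv_into_f)
  ultimately show ?thesis
    using has_derivative_transform_within_open[OF _ \<open>open S\<close> \<open>x \<in> S\<close>] unfolding \<psi>_def by blast
qed

lemma dpos_transition: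
  assumes "(V, g) \<in> atlas M" "x \<in> V" "(W, h) \<in> atlas M" "y \<in> W" "g x = h y"
  shows "dpos g x v = dpos h y (frechet_derivative (\<lambda>z. inv_into W h (g z)) (at x) v)"
  using fun_cong[OF frechet_derivative_at[OF has_derivative_transition[OF assms
        smooth_map_differentiable[OF smooth_pos assms(3,4)]]], of v] by simp

lemma tangent_space_chart:
  assumes "(V, g) \<in> atlas M" "x \<in> V"
  shows "tangent_space M (g x) = range (dpos g x)"
proof
  show "tangent_space M (g x) \<subseteq> range (dpos g x)"
  proof
    fix w assume "w \<in> tangent_space M (g x)"
    then obtain W h y v where h: "(W, h) \<in> atlas M" "y \<in> W" "h y = g x" "w = dpos h y v"
      unfolding tangent_space_def by auto
    show "w \<in> range (dpos g x)"
      using dpos_transition[OF h(1,2) assms h(3), of v] h(4) by simp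
  qed
qed (use dpos_tangent[OF assms] in auto)

lemma subspace_tangent_space:
  assumes "p \<in> points M"
  shows "subspace (tangent_space M p)"
  using assms tangent_space_chart linear_dpos
  by (metis point_chart linear_subspace_image subspace_UNIV)

lemma has_differential_deriv_along:
  assumes "\<And>V g x. (V, g) \<in> atlas M \<Longrightarrow> x \<in> V \<Longrightarrow> g x = p \<Longrightarrow> (f \<circ> g) differentiable (at x)"
  shows "has_differential M f (deriv_along M f p) p"
proof (rule has_differentialI)
  fix V g x assume g: "(V, g) \<in> atlas M" "x \<in> V" "g x = p"
  have "deriv_along M f p (dpos g x v) = frechet_derivative (f \<circ> g) (at x) v" for v
    unfolding deriv_along_def
  proof (rule the_equality)
    show "\<exists>(V, h)\<in>atlas M. \<exists>y\<in>V. \<exists>u. h y = p \<and> dpos h y u = dpos g x v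
        \<and> frechet_derivative (f \<circ> h) (at y) u = frechet_derivative (f \<circ> g) (at x) v"
      using g by blast
    fix d assume "\<exists>(V, h)\<in>atlas M. \<exists>y\<in>V. \<exists>u. h y = p \<and> dpos h y u = dpos g x v
        \<and> frechet_derivative (f \<circ> h) (at y) u = d"
    then obtain W h y u where h: "(W, h) \<in> atlas M" "y \<in> W" "h y = p"
        "dpos h y u = dpos g x v" "d = frechet_derivative (f \<circ> h) (at y) u" by auto
    have eq: "g x = h y" using g(3) h(3) by simp
    have "u = frechet_derivative (\<lambda>z. inv_into W h (g z)) (at x) v"
      using dpos_transition[OF g(1,2) h(1,2) eq, of v] h(4) inj_dpos[OF h(1,2)]
      by (metis injD)
    then show "d = frechet_derivative (f \<circ> g) (at x) v"
      using fun_cong[OF frechet_derivative_at[OF has_derivative_transition[OF g(1,2) h(1,2) eq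
              assms[OF h(1-3)]]], of v] h(5) by simp
  qed
  then show "((f \<circ> g) has_derivative (\<lambda>v. deriv_along M f p (dpos g x v))) (at x)"
    using assms[OF g] by (simp add: frechet_derivative_works)
qed

lemma smooth_map_has_differential:
  "smooth_map M f \<Longrightarrow> has_differential M f (deriv_along M f p) p"
  by (intro has_differential_deriv_along smooth_map_differentiable)

lemma has_differential_cong:
  assumes "has_differential M f D p" "\<And>q. q \<in> points M \<Longrightarrow> f q = h q"
  shows "has_differential M h D p"
proof (rule has_differentialI)
  fix V g x assume g: "(V, g) \<in> atlas M" "x \<in> V" "g x = p"
  show "((h \<circ> g) has_derivative (\<lambda>v. D (dpos g x v))) (at x)"
    using has_derivative_transform_within_open[OF has_differentialD[OF assms(1) g]
        open_chart[OF g(1)] g(2)] assms(2) chart_point[OF g(1)] by simp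
qed

lemma has_differential_pos: "has_differential M (pos M) (\<lambda>w. w) p"
  using smooth_map_differentiable[OF smooth_pos]
  by (intro has_differentialI) (simp add: frechet_derivative_works[symmetric])

lemma differential_linear:
  assumes "has_differential M f D p" "p \<in> points M" "v \<in> tangent_space M p" "w \<in> tangent_space M p"
  shows "D (v + w) = D v + D w" "D (c *\<^sub>R v) = c *\<^sub>R D v"
proof -
  obtain V g x where g: "(V, g) \<in> atlas M" "x \<in> V" "g x = p"
    using point_chart[OF assms(2)] .
  obtain a b where ab: "v = dpos g x a" "w = dpos g x b"
    using assms(3,4) tangent_space_chart[OF g(1,2)] g(3) by auto
  have lin: "linear (\<lambda>v. D (dpos g x v))"
    using has_derivative_linear[OF has_differentialD[OF assms(1) g]] .
  show "D (v + w) = D v + D w"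
    using linear_add[OF lin, of a b] linear_add[OF linear_dpos[OF g(1,2)], of a b] by (simp add: ab)
  show "D (c *\<^sub>R v) = c *\<^sub>R D v"
    using linear_scale[OF lin, of c a] linear_scale[OF linear_dpos[OF g(1,2)], of c a]
    by (simp add: ab)
qed

text \<open>Differentiability of the coordinates is not part of the notion of a tangent field, which is a
  smooth map into Minkowski space; it comes from inverting the first fundamental form.\<close>

lemma coordinate_field:
  assumes "tangent_field M X" "(V, g) \<in> atlas M"
  obtains u where "\<And>x. x \<in> V \<Longrightarrow> dpos g x (u x) = X (g x)"
    "\<And>x. x \<in> V \<Longrightarrow> u differentiable (at x)"
proof -
  have "\<exists>a. dpos g x a = X (g x)" if "x \<in> V" for x
    using assms(1) chart_point[OF assms(2) that] tangent_space_chart[OF assms(2) that]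
    unfolding tangent_field_def by (metis imageE)
  then obtain u where u: "\<And>x. x \<in> V \<Longrightarrow> dpos g x (u x) = X (g x)" by metis
  have "Ck_on (Suc (Suc 0)) V (pos M \<circ> g)"
    using smooth_map_Ck[OF smooth_pos assms(2)] .
  then have G: "(\<lambda>y. dpos g y a) differentiable (at x)" if "x \<in> V" for x a
    using that by (simp del: o_apply)
  have "u differentiable (at x)" if "x \<in> V" for x
  proof (rule differentiable_coordinates[OF open_chart[OF assms(2)] that])
    show "lorentz (dpos g y a) (dpos g y a) > 0" if "y \<in> V" "dpos g y a \<noteq> 0" for y a
      using tangent_pos[OF chart_point[OF assms(2) that(1)] dpos_tangent[OF assms(2) that(1)] that(2)] .
    show "(X \<circ> g) differentiable (at x)"
      using assms that smooth_map_differentiable unfolding tangent_field_def by blast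
    show "dpos g y (u y) = (X \<circ> g) y" if "y \<in> V" for y
      using u[OF that] by simp
  qed (use linear_dpos inj_dpos assms(2) G that in blast)+
  then show ?thesis using that u by blast
qed

lemma deriv_along_field_has_derivative:
  fixes f :: "'a \<Rightarrow> 'b::real_inner"
  assumes f: "smooth_map M f" and g: "(V, g) \<in> atlas M" "x \<in> V"
    and v: "\<And>y. y \<in> V \<Longrightarrow> dpos g y (v y) = Y (g y)" "(v has_derivative v') (at x)"
  shows "(((\<lambda>q. deriv_along M f q (Y q)) \<circ> g) has_derivative
    (\<lambda>a. frechet_derivative (f \<circ> g) (at x) (v' a)
       + frechet_derivative (\<lambda>y. frechet_derivative (f \<circ> g) (at y) a) (at x) (v x))) (at x)"
proof (rule has_derivative_transform_within_open[OF
      has_derivative_frechet_derivative_apply[OF open_chart[OF g(1)] g(2) smooth_map_Ck[OF f g(1)] v(2)]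
      open_chart[OF g(1)] g(2)])
  show "frechet_derivative (f \<circ> g) (at y) (v y) = ((\<lambda>q. deriv_along M f q (Y q)) \<circ> g) y"
    if "y \<in> V" for y
    using fun_cong[OF frechet_derivative_at[OF
          has_differentialD[OF smooth_map_has_differential[OF f] g(1) that refl]], of "v y"] v(1)[OF that]
    by simp
qed

lemma has_differential_deriv_along_field:
  fixes f :: "'a \<Rightarrow> 'b::real_inner"
  assumes f: "smooth_map M f" and Y: "tangent_field M Y"
  shows "has_differential M (\<lambda>q. deriv_along M f q (Y q))
    (deriv_along M (\<lambda>q. deriv_along M f q (Y q)) p) p"
proof (rule has_differential_deriv_along)
  fix V g x assume g: "(V, g) \<in> atlas M" "x \<in> V" "g x = p"
  obtain v where "\<And>y. y \<in> V \<Longrightarrow> dpos g y (v y) = Y (g y)" "v differentiable (at x)"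
    using coordinate_field[OF Y g(1)] g(2) by metis
  then show "((\<lambda>q. deriv_along M f q (Y q)) \<circ> g) differentiable (at x)"
    using deriv_along_field_has_derivative[OF f g(1,2)] unfolding differentiable_def by blast
qed

text \<open>The ambient connection is flat. In a chart, with \<open>u\<close> and \<open>v\<close> the coordinates of \<open>X\<close> and \<open>Y\<close>,
  the Hessian terms of the two second derivatives cancel by symmetry, which leaves the derivative of \<open>f\<close>
  in the direction \<open>v'(u) - u'(v)\<close>. The case \<open>f = pos M\<close> identifies this direction with the
  bracket and shows that the bracket is tangent.\<close>

lemma deriv_along_commutator:
  fixes f :: "'a \<Rightarrow> 'b::real_inner"
  assumes f: "smooth_map M f" and X: "tangent_field M X" and Y: "tangent_field M Y"
    and p: "p \<in> points M"
  shows "lie_bracket M X Y p \<in> tangent_space M p" (is ?tangent)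
    and "deriv_along M (\<lambda>q. deriv_along M f q (Y q)) p (X p)
       - deriv_along M (\<lambda>q. deriv_along M f q (X q)) p (Y p)
       = deriv_along M f p (lie_bracket M X Y p)" (is ?commutator)
proof -
  obtain V g x where g: "(V, g) \<in> atlas M" "x \<in> V" "g x = p"
    using point_chart[OF p] .
  obtain u where u: "\<And>y. y \<in> V \<Longrightarrow> dpos g y (u y) = X (g y)" "u differentiable (at x)"
    using coordinate_field[OF X g(1)] g(2) by metis
  obtain v where v: "\<And>y. y \<in> V \<Longrightarrow> dpos g y (v y) = Y (g y)" "v differentiable (at x)"
    using coordinate_field[OF Y g(1)] g(2) by metis
  define u' where "u' = frechet_derivative u (at x)"
  define v' where "v' = frechet_derivative v (at x)"
  have u': "(u has_derivative u') (at x)" and v': "(v has_derivative v') (at x)"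
    using u(2) v(2) by (simp_all add: u'_def v'_def frechet_derivative_works)
  have second: "deriv_along M (\<lambda>q. deriv_along M f q (Y q)) p (X p)
      = frechet_derivative (f \<circ> g) (at x) (v' (u x))
        + frechet_derivative (\<lambda>y. frechet_derivative (f \<circ> g) (at y) (u x)) (at x) (v x)"
    if f: "smooth_map M f" and Y: "tangent_field M Y"
      and u: "\<And>y. y \<in> V \<Longrightarrow> dpos g y (u y) = X (g y)"
      and v: "\<And>y. y \<in> V \<Longrightarrow> dpos g y (v y) = Y (g y)" "(v has_derivative v') (at x)"
    for f :: "'a \<Rightarrow> 'c::real_inner" and X Y u v v'
    using fun_cong[OF has_derivative_unique[OF
          has_differentialD[OF has_differential_deriv_along_field[OF f Y] g]
          deriv_along_field_has_derivative[OF f g(1,2) v]], of "u x"] u[OF g(2)] g(3)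
    by simp
  have commute: "deriv_along M (\<lambda>q. deriv_along M f q (Y q)) p (X p)
      - deriv_along M (\<lambda>q. deriv_along M f q (X q)) p (Y p)
      = frechet_derivative (f \<circ> g) (at x) (v' (u x) - u' (v x))"
    if f: "smooth_map M f" for f :: "'a \<Rightarrow> 'c::real_inner"
    using second[OF f Y u(1) v(1) v'] second[OF f X v(1) u(1) u']
      symmetric_second_derivative[OF open_chart[OF g(1)] g(2) smooth_map_Ck[OF f g(1)], of "u x" "v x"]
      linear_diff[OF linear_frechet_derivative[OF smooth_map_differentiable[OF f g(1,2)]]]
    by simp
  have field: "deriv_along M (\<lambda>q. deriv_along M (pos M) q (Z q)) p w = deriv_along M Z p w"
    if "tangent_field M Z" "w \<in> tangent_space M p" for Z w
  proof (rule deriv_along_eq[OF has_differential_cong that(2)])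
    show "has_differential M Z (deriv_along M Z p) p"
      using that(1) smooth_map_has_differential unfolding tangent_field_def by blast
    show "Z q = deriv_along M (pos M) q (Z q)" if "q \<in> points M" for q
      using deriv_along_eq[OF has_differential_pos] that \<open>tangent_field M Z\<close>
      unfolding tangent_field_def by simp
  qed
  have "X p \<in> tangent_space M p" "Y p \<in> tangent_space M p"
    using X Y p unfolding tangent_field_def by auto
  then have bracket: "lie_bracket M X Y p = dpos g x (v' (u x) - u' (v x))"
    using commute[OF smooth_pos] field X Y by (simp add: lie_bracket_def)
  then show ?tangent using dpos_tangent[OF g(1,2)] g(3) by simp
  show ?commutator
    unfolding commute[OF f] bracket
    using fun_cong[OF frechet_derivative_at[OF has_differentialD[OF
            smooth_map_has_differential[OF f] g]]] by simp
qed

end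

section \<open>The normal frame on the cylinder over the light cone\<close>

lemma bounded_linear_drop_axis:
  "bounded_linear (\<lambda>w :: 'n::finite mink. w - lorentz w axis_last *\<^sub>R axis_last)"
  by (intro bounded_linear_sub bounded_linear_ident
      bounded_linear_compose[OF bounded_linear_scaleR_left lorentz.bounded_linear_left])

lemma theta_eq: "theta M p = pos M p - lorentz (pos M p) axis_last *\<^sub>R axis_last"
  by (cases "pos M p") (simp add: theta_def lorentz_def axis_last_def)

lemma lorentz_theta_axis: "lorentz (theta M p) axis_last = 0"
  by (cases "pos M p") (simp add: theta_def lorentz_def axis_last_def)

lemma lorentz_axis_axis: "lorentz axis_last (axis_last :: 'n::finite mink) = 1"
  by (simp add: lorentz_def axis_last_def)

locale cone_submfd = riemannian_submfd M
  for M :: "('a, 'n::finite) submfd" +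
  fixes \<xi> :: "'a \<Rightarrow> 'n mink"
  assumes cone: "pos M ` points M \<subseteq> light_cone_cylinder"
    and normal_xi: "normal_field M \<xi>"
    and xi_null: "\<And>p. p \<in> points M \<Longrightarrow> lorentz (\<xi> p) (\<xi> p) = 0"
    and xi_theta: "\<And>p. p \<in> points M \<Longrightarrow> lorentz (\<xi> p) (theta M p) = - 1"
begin

abbreviation \<theta> :: "'a \<Rightarrow> 'n mink" where "\<theta> \<equiv> theta M"

text \<open>Up to the factor \<open>lorentz w axis_last\<close>, this is the value at \<open>w\<close> of the connection form of the
  normal bundle in the frame \<open>\<theta>\<close>, \<open>\<xi>\<close>; see \<open>normal_connection_eq\<close>. It is the function \<open>\<alpha>\<close> of an
  adapted frame, here given directly by \<open>\<xi>\<close>.\<close>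

definition conn_coeff :: "'a \<Rightarrow> real" where
  "conn_coeff p = lorentz (\<xi> p) axis_last"

lemma differential_eq_0:
  assumes "has_differential M f D p" "\<And>q. q \<in> points M \<Longrightarrow> f q = c" "w \<in> tangent_space M p"
  shows "D w = 0"
  using differential_unique[OF has_differential_cong[OF assms(1,2)] has_differential_const assms(3)] .

lemma theta_null: "p \<in> points M \<Longrightarrow> lorentz (\<theta> p) (\<theta> p) = 0"
proof -
  assume "p \<in> points M"
  then have "pos M p \<in> light_cone_cylinder" using cone by blast
  then show ?thesis
    by (cases "pos M p")
       (auto simp: theta_def lorentz_def light_cone_cylinder_def inner_vec_def power2_eq_square)
qed

lemma smooth_theta: "smooth_map M \<theta>"
  using smooth_map_linear[OF bounded_linear_drop_axis smooth_pos]
  by (simp add: theta_eq[abs_def])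

lemma has_differential_theta:
  "has_differential M \<theta> (\<lambda>w. w - lorentz w axis_last *\<^sub>R axis_last) p"
  using has_differential_linear[OF bounded_linear_drop_axis has_differential_pos]
  by (simp add: theta_eq[abs_def])

lemma smooth_xi: "smooth_map M \<xi>"
  using normal_xi unfolding normal_field_def by blast

lemma has_differential_xi: "has_differential M \<xi> (deriv_along M \<xi> p) p"
  by (rule smooth_map_has_differential[OF smooth_xi])

lemma smooth_conn: "smooth_map M conn_coeff"
  unfolding conn_coeff_def[abs_def]
  by (rule smooth_map_bilinear[OF bounded_bilinear_lorentz smooth_xi smooth_map_const])

lemma xi_tangent: "p \<in> points M \<Longrightarrow> w \<in> tangent_space M p \<Longrightarrow> lorentz (\<xi> p) w = 0"
  using normal_xi unfolding normal_field_def normal_space_def by blast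

text \<open>Since \<open>\<theta>\<close> is null, it is orthogonal to its derivative along \<open>w\<close>. This derivative differs from
  \<open>w\<close> by a multiple of \<open>axis_last\<close>, to which \<open>\<theta>\<close> is orthogonal as well.\<close>

lemma theta_tangent:
  assumes "p \<in> points M" "w \<in> tangent_space M p"
  shows "lorentz (\<theta> p) w = 0"
  using differential_eq_0[OF has_differential_lorentz[OF has_differential_theta
        has_differential_theta] theta_null assms(2)]
  by (simp add: lorentz.diff_right lorentz.diff_left lorentz.scaleR_left lorentz.scaleR_right
      lorentz_theta_axis lorentz_commute[of _ "\<theta> p"])

text \<open>By dimension, \<open>\<theta>\<close> and \<open>\<xi>\<close> span the normal space: tangent space and frame together give an
  injective linear map from a space of dimension \<open>n + 2\<close> to Minkowski space, which is then
  surjective. The coefficients come from pairing with the null frame.\<close>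

lemma normal_part_removed_tangent:
  assumes "p \<in> points M"
  shows "w + lorentz w (\<xi> p) *\<^sub>R \<theta> p + lorentz w (\<theta> p) *\<^sub>R \<xi> p \<in> tangent_space M p"
proof -
  obtain V g x where g: "(V, g) \<in> atlas M" "x \<in> V" "g x = p"
    using point_chart[OF assms] .
  \<comment> \<open>Minkowski space itself serves as the parameter space: its first and last coordinates are
      the coefficients of the frame, and its middle part is the chart space.\<close>
  define \<Phi> :: "'n mink \<Rightarrow> 'n mink"
    where "\<Phi> u = fst u *\<^sub>R \<theta> p + dpos g x (fst (snd u)) + snd (snd u) *\<^sub>R \<xi> p" for u
  have tan: "dpos g x v \<in> tangent_space M p" for v
    using dpos_tangent[OF g(1,2)] g(3) by simp
  have pairings: "lorentz (\<Phi> u) (\<xi> p) = - fst u" "lorentz (\<Phi> u) (\<theta> p) = - snd (snd u)" for u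
    using xi_null[OF assms] theta_null[OF assms] xi_theta[OF assms]
      xi_tangent[OF assms tan] theta_tangent[OF assms tan]
    by (simp_all add: \<Phi>_def lorentz.add_left lorentz.scaleR_left
        lorentz_commute[of "\<theta> p" "\<xi> p"] lorentz_commute[of "dpos g x _"])
  have "linear \<Phi>"
    using linear_add[OF linear_dpos[OF g(1,2)]] linear_scale[OF linear_dpos[OF g(1,2)]]
    by (intro linearI) (simp_all add: \<Phi>_def algebra_simps)
  moreover have "u = 0" if "\<Phi> u = 0" for u
  proof -
    have "fst u = 0" "snd (snd u) = 0"
      using pairings[of u] that by (simp_all add: lorentz.zero_left)
    with that have "dpos g x (fst (snd u)) = 0"
      by (simp add: \<Phi>_def)
    then have "fst (snd u) = 0"
      using inj_dpos[OF g(1,2)] linear_dpos[OF g(1,2)] by (metis injD linear_0)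
    with \<open>fst u = 0\<close> \<open>snd (snd u) = 0\<close> show ?thesis
      by (simp add: prod_eq_iff)
  qed
  ultimately have "surj \<Phi>"
    using linear_injective_0 linear_injective_imp_surjective by blast
  then obtain u where u: "w = \<Phi> u" by blast
  have "w + lorentz w (\<xi> p) *\<^sub>R \<theta> p + lorentz w (\<theta> p) *\<^sub>R \<xi> p = dpos g x (fst (snd u))"
    unfolding u pairings by (simp add: \<Phi>_def)
  then show ?thesis using tan by simp
qed

lemma tangential_part_eq:
  assumes "p \<in> points M"
  shows "tangential_part M p w = w + lorentz w (\<xi> p) *\<^sub>R \<theta> p + lorentz w (\<theta> p) *\<^sub>R \<xi> p"
    (is "_ = ?u")
  unfolding tangential_part_def orth_proj_def
proof (rule the_equality)
  have normal: "lorentz (w - ?u) v = 0" if "v \<in> tangent_space M p" for v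
    using xi_tangent[OF assms that] theta_tangent[OF assms that]
    by (simp add: lorentz.diff_left lorentz.add_left lorentz.scaleR_left lorentz.minus_left)
  then show "?u \<in> tangent_space M p \<and> (\<forall>v\<in>tangent_space M p. lorentz (w - ?u) v = 0)"
    using normal_part_removed_tangent[OF assms] by blast
  fix u assume u: "u \<in> tangent_space M p \<and> (\<forall>v\<in>tangent_space M p. lorentz (w - u) v = 0)"
  have tan: "u - ?u \<in> tangent_space M p"
    using u normal_part_removed_tangent[OF assms] subspace_diff[OF subspace_tangent_space[OF assms]]
    by blast
  have telescope: "lorentz (a - b) z = lorentz (c - b) z - lorentz (c - a) z" for a b c z :: "'n mink"
    by (simp add: lorentz.diff_left)
  have "lorentz (u - ?u) (u - ?u) = lorentz (w - ?u) (u - ?u) - lorentz (w - u) (u - ?u)"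
    by (rule telescope)
  also have "\<dots> = 0"
    using u normal tan by simp
  finally show "u = ?u"
    using tangent_pos[OF assms tan] by fastforce
qed

text \<open>Tangential parts of constant vectors are smooth because the frame is. They are the only
  tangent fields that have to be constructed: they realise every tangent vector at a given point without
  cutoff functions, and the field \<open>e\<^sub>1\<close> is the one for \<open>axis_last\<close>.\<close>

lemma tangential_part_tangent_field: "tangent_field M (\<lambda>p. tangential_part M p c)"
proof -
  have "smooth_map M (\<lambda>p. c + lorentz c (\<xi> p) *\<^sub>R \<theta> p + lorentz c (\<theta> p) *\<^sub>R \<xi> p)"
    by (intro smooth_map_add smooth_map_const smooth_map_bilinear[OF bounded_bilinear_scaleR]
        smooth_map_bilinear[OF bounded_bilinear_lorentz] smooth_xi smooth_theta)
  then have "smooth_map M (\<lambda>p. tangential_part M p c)"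
    by (rule smooth_map_cong) (simp add: tangential_part_eq)
  then show ?thesis
    unfolding tangent_field_def
    using tangential_part_eq normal_part_removed_tangent by simp
qed

lemma e1_field_eq: "p \<in> points M \<Longrightarrow> e1_field M p = axis_last + conn_coeff p *\<^sub>R \<theta> p"
  unfolding e1_field_def
  by (simp add: tangential_part_eq conn_coeff_def lorentz_theta_axis lorentz_commute[of axis_last])

lemma e1_tangent: "p \<in> points M \<Longrightarrow> e1_field M p \<in> tangent_space M p"
  using tangential_part_tangent_field unfolding tangent_field_def e1_field_def by blast

lemma lorentz_e1_axis: "p \<in> points M \<Longrightarrow> lorentz (e1_field M p) axis_last = 1"
  by (simp add: e1_field_eq lorentz.add_left lorentz.scaleR_left lorentz_theta_axis lorentz_axis_axis)

lemma lorentz_e1_tangent: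
  "p \<in> points M \<Longrightarrow> w \<in> tangent_space M p \<Longrightarrow> lorentz w (e1_field M p) = lorentz w axis_last"
  using theta_tangent
  by (simp add: e1_field_eq lorentz.add_right lorentz.scaleR_right lorentz_commute[of w "\<theta> p"])

section \<open>Normal connection and normal curvature\<close>

text \<open>Differentiating the relations between the frame vectors shows that the derivatives of \<open>\<theta>\<close> and
  \<open>\<xi>\<close> have no normal component other than along \<open>\<theta>\<close> and \<open>\<xi>\<close>, respectively, with opposite
  coefficients. The coefficient is explicit since the derivative of \<open>\<theta>\<close> along \<open>w\<close> is
  \<open>w - lorentz w axis_last *\<^sub>R axis_last\<close>.\<close>

lemma normal_connection_eq:
  assumes p: "p \<in> points M" and X: "X p \<in> tangent_space M p"
    and a: "has_differential M a a' p" and b: "has_differential M b b' p"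
    and \<zeta>: "\<And>q. q \<in> points M \<Longrightarrow> \<zeta> q = a q *\<^sub>R \<theta> q + b q *\<^sub>R \<xi> q"
  shows "normal_connection M X \<zeta> p =
      (a' (X p) + conn_coeff p * lorentz (X p) axis_last * a p) *\<^sub>R \<theta> p
    + (b' (X p) - conn_coeff p * lorentz (X p) axis_last * b p) *\<^sub>R \<xi> p"
proof -
  define h where "h = lorentz (X p) axis_last"
  define dt where "dt = X p - h *\<^sub>R axis_last"
  define dx where "dx = deriv_along M \<xi> p (X p)"
  define W where "W = a p *\<^sub>R dt + a' (X p) *\<^sub>R \<theta> p + (b p *\<^sub>R dx + b' (X p) *\<^sub>R \<xi> p)"
  have "has_differential M \<zeta> (\<lambda>w.
      (a p *\<^sub>R (w - lorentz w axis_last *\<^sub>R axis_last) + a' w *\<^sub>R \<theta> p)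
      + (b p *\<^sub>R deriv_along M \<xi> p w + b' w *\<^sub>R \<xi> p)) p"
    by (rule has_differential_cong[OF has_differential_add[OF
            has_differential_scaleR[OF a has_differential_theta]
            has_differential_scaleR[OF b has_differential_xi]]])
       (simp add: \<zeta>)
  then have W: "deriv_along M \<zeta> p (X p) = W"
    using deriv_along_eq[OF _ X] by (simp add: W_def dt_def dx_def h_def)
  have "lorentz dt (\<xi> p) = - (conn_coeff p * h)"
    using xi_tangent[OF p X]
    by (simp add: dt_def conn_coeff_def lorentz.diff_right lorentz.scaleR_right lorentz_commute[of _ "\<xi> p"])
  moreover have "lorentz dt (\<theta> p) = 0"
    using theta_tangent[OF p X]
    by (simp add: dt_def lorentz.diff_right lorentz.scaleR_right lorentz_commute[of _ "\<theta> p"]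
        lorentz_theta_axis)
  moreover have "lorentz dx (\<xi> p) = 0"
    using differential_eq_0[OF has_differential_lorentz[OF has_differential_xi has_differential_xi]
        xi_null X]
    by (simp add: dx_def lorentz_commute[of "\<xi> p"])
  moreover have "lorentz (\<xi> p) dt + lorentz dx (\<theta> p) = 0"
    using differential_eq_0[OF has_differential_lorentz[OF has_differential_xi has_differential_theta]
        xi_theta X]
    by (simp add: dx_def dt_def h_def)
  ultimately have W_pairings: "lorentz W (\<xi> p) = - (a' (X p) + conn_coeff p * h * a p)"
    "lorentz W (\<theta> p) = - (b' (X p) - conn_coeff p * h * b p)"
    using xi_null[OF p] theta_null[OF p] xi_theta[OF p]
    by (simp_all add: W_def lorentz.add_left lorentz.scaleR_left lorentz_commute[of "\<theta> p" "\<xi> p"]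
        lorentz_commute[of "\<xi> p" dt] algebra_simps)
  then show ?thesis
    unfolding normal_connection_def W tangential_part_eq[OF p] h_def[symmetric] W_pairings
    by (simp only: scaleR_minus_left) simp
qed

text \<open>A normal vector with its components along \<open>\<theta>\<close> and \<open>\<xi>\<close> removed is both normal and tangent, and so
  it vanishes by definiteness of the induced metric.\<close>

lemma normal_field_eq:
  assumes "normal_field M \<zeta>" "p \<in> points M"
  shows "\<zeta> p = (- lorentz (\<zeta> p) (\<xi> p)) *\<^sub>R \<theta> p + (- lorentz (\<zeta> p) (\<theta> p)) *\<^sub>R \<xi> p"
proof -
  have normal: "lorentz (\<zeta> p) w = 0" if "w \<in> tangent_space M p" for w
    using assms that unfolding normal_field_def normal_space_def by blast
  let ?u = "\<zeta> p + lorentz (\<zeta> p) (\<xi> p) *\<^sub>R \<theta> p + lorentz (\<zeta> p) (\<theta> p) *\<^sub>R \<xi> p"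
  have tan: "?u \<in> tangent_space M p"
    by (rule normal_part_removed_tangent[OF assms(2)])
  have "lorentz ?u ?u = 0"
    using normal[OF tan] xi_tangent[OF assms(2) tan] theta_tangent[OF assms(2) tan]
    by (subst lorentz.add_left, subst lorentz.add_left) (simp add: lorentz.scaleR_left)
  then have "?u = 0"
    using tangent_pos[OF assms(2) tan] by fastforce
  then show ?thesis
    by (simp add: eq_neg_iff_add_eq_0 algebra_simps)
qed

text \<open>With connection form \<open>\<omega> = \<alpha> ds\<close>, where \<open>s\<close> is the last coordinate and \<open>ds\<close> is the product with
  \<open>axis_last\<close>, the curvature is \<open>d\<omega> = d\<alpha> \<and> ds\<close> on \<open>\<theta>\<close> and its negative on \<open>\<xi>\<close>. In the computation
  the second derivatives of the coefficients of \<open>\<zeta>\<close> cancel by \<open>deriv_along_commutator\<close>, and so do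
  those of \<open>s\<close>, by the definition of the bracket.\<close>

lemma normal_curvature_eq:
  assumes X: "tangent_field M X" and Y: "tangent_field M Y" and \<zeta>: "normal_field M \<zeta>"
    and p: "p \<in> points M"
  shows "normal_curvature M X Y \<zeta> p =
    (deriv_along M conn_coeff p (X p) * lorentz (Y p) axis_last
       - deriv_along M conn_coeff p (Y p) * lorentz (X p) axis_last)
    *\<^sub>R (lorentz (\<zeta> p) (\<theta> p) *\<^sub>R \<xi> p - lorentz (\<zeta> p) (\<xi> p) *\<^sub>R \<theta> p)"
proof -
  define a where "a q = - lorentz (\<zeta> q) (\<xi> q)" for q
  define b where "b q = - lorentz (\<zeta> q) (\<theta> q)" for q
  define ht where "ht w = lorentz w axis_last" for w :: "'n mink"
  have tan: "Z q \<in> tangent_space M q" if "tangent_field M Z" "q \<in> points M" for Z q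
    using that unfolding tangent_field_def by blast
  have smooth: "smooth_map M a" "smooth_map M b"
    using \<zeta> smooth_xi smooth_theta unfolding a_def[abs_def] b_def[abs_def] normal_field_def
    by (auto intro!: smooth_map_linear[OF bounded_linear_minus[OF bounded_linear_ident]]
        smooth_map_bilinear[OF bounded_bilinear_lorentz])
  have \<zeta>_eq: "\<zeta> q = a q *\<^sub>R \<theta> q + b q *\<^sub>R \<xi> q" if "q \<in> points M" for q
    using normal_field_eq[OF \<zeta> that] by (simp add: a_def b_def)
  \<comment> \<open>The coefficients of the normal derivative of \<open>\<zeta>\<close> along \<open>Z\<close>.\<close>
  define a1 where "a1 Z q = deriv_along M a q (Z q) + conn_coeff q * ht (Z q) * a q" for Z q
  define b1 where "b1 Z q = deriv_along M b q (Z q) + - (conn_coeff q * ht (Z q) * b q)" for Z q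
  have first: "normal_connection M Z \<zeta> q = a1 Z q *\<^sub>R \<theta> q + b1 Z q *\<^sub>R \<xi> q"
    if "q \<in> points M" "Z q \<in> tangent_space M q" for Z q
    using normal_connection_eq[of q Z a _ b _ \<zeta>, OF that
        smooth[THEN smooth_map_has_differential] \<zeta>_eq]
    by (simp add: a1_def b1_def ht_def)
  have dh: "has_differential M (\<lambda>q. ht (Z q)) (\<lambda>w. ht (deriv_along M Z p w)) p"
    if "tangent_field M Z" for Z
    unfolding ht_def using that unfolding tangent_field_def
    by (intro has_differential_linear[OF lorentz.bounded_linear_left] smooth_map_has_differential) simp
  note dconn = smooth_map_has_differential[OF smooth_conn, of p]
  \<comment> \<open>The differentials at \<open>p\<close> of these coefficients.\<close>
  define a2 where "a2 Z w = deriv_along M (\<lambda>q. deriv_along M a q (Z q)) p w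
      + (conn_coeff p * ht (Z p) * deriv_along M a p w
      + (conn_coeff p * ht (deriv_along M Z p w) + deriv_along M conn_coeff p w * ht (Z p)) * a p)" for Z w
  define b2 where "b2 Z w = deriv_along M (\<lambda>q. deriv_along M b q (Z q)) p w
      + - (conn_coeff p * ht (Z p) * deriv_along M b p w
      + (conn_coeff p * ht (deriv_along M Z p w) + deriv_along M conn_coeff p w * ht (Z p)) * b p)" for Z w
  have d1: "has_differential M (a1 Z) (a2 Z) p" "has_differential M (b1 Z) (b2 Z) p"
    if "tangent_field M Z" for Z
    unfolding a1_def[abs_def] a2_def[abs_def] b1_def[abs_def] b2_def[abs_def]
    by (rule has_differential_add[OF has_differential_deriv_along_field[OF smooth(1) that]
          has_differential_mult[OF has_differential_mult[OF dconn dh[OF that]]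
            smooth_map_has_differential[OF smooth(1)]]],
        rule has_differential_add[OF has_differential_deriv_along_field[OF smooth(2) that]
          has_differential_minus[OF has_differential_mult[OF has_differential_mult[OF dconn dh[OF that]]
            smooth_map_has_differential[OF smooth(2)]]]])
  have second: "normal_connection M Z' (normal_connection M Z \<zeta>) p
      = (a2 Z (Z' p) + conn_coeff p * ht (Z' p) * a1 Z p) *\<^sub>R \<theta> p
      + (b2 Z (Z' p) - conn_coeff p * ht (Z' p) * b1 Z p) *\<^sub>R \<xi> p"
    if "tangent_field M Z" "tangent_field M Z'" for Z Z'
    unfolding ht_def
    by (rule normal_connection_eq[of p Z' "a1 Z" _ "b1 Z", OF p tan[OF that(2) p] d1[OF that(1)]])
       (simp add: first tan[OF that(1)])
  note bracket = deriv_along_commutator[OF _ X Y p]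
  have la: "deriv_along M a p (lie_bracket M X Y p)
      = deriv_along M (\<lambda>q. deriv_along M a q (Y q)) p (X p)
      - deriv_along M (\<lambda>q. deriv_along M a q (X q)) p (Y p)"
    using bracket(2)[OF smooth(1)] by simp
  have lb: "deriv_along M b p (lie_bracket M X Y p)
      = deriv_along M (\<lambda>q. deriv_along M b q (Y q)) p (X p)
      - deriv_along M (\<lambda>q. deriv_along M b q (X q)) p (Y p)"
    using bracket(2)[OF smooth(2)] by simp
  have lh: "ht (lie_bracket M X Y p) = ht (deriv_along M Y p (X p)) - ht (deriv_along M X p (Y p))"
    by (simp add: ht_def lie_bracket_def lorentz.diff_left)
  define k where "k = deriv_along M conn_coeff p (X p) * ht (Y p) - deriv_along M conn_coeff p (Y p) * ht (X p)"
  have "a2 Y (X p) + conn_coeff p * ht (X p) * a1 Y p - (a2 X (Y p) + conn_coeff p * ht (Y p) * a1 X p)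
      - a1 (lie_bracket M X Y) p = k * a p"
    unfolding a1_def a2_def la lh k_def by (simp add: algebra_simps)
  moreover have "b2 Y (X p) - conn_coeff p * ht (X p) * b1 Y p - (b2 X (Y p) - conn_coeff p * ht (Y p) * b1 X p)
      - b1 (lie_bracket M X Y) p = - k * b p"
    unfolding b1_def b2_def lb lh k_def by (simp add: algebra_simps)
  moreover have "normal_curvature M X Y \<zeta> p =
      (a2 Y (X p) + conn_coeff p * ht (X p) * a1 Y p - (a2 X (Y p) + conn_coeff p * ht (Y p) * a1 X p)
      - a1 (lie_bracket M X Y) p) *\<^sub>R \<theta> p
    + (b2 Y (X p) - conn_coeff p * ht (X p) * b1 Y p - (b2 X (Y p) - conn_coeff p * ht (Y p) * b1 X p)
      - b1 (lie_bracket M X Y) p) *\<^sub>R \<xi> p"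
    unfolding normal_curvature_def second[OF Y X] second[OF X Y]
      first[of p "lie_bracket M X Y", OF p bracket(1)[OF smooth(1)]]
    by (simp only: scaleR_left_diff_distrib) simp
  ultimately have "normal_curvature M X Y \<zeta> p = (k * a p) *\<^sub>R \<theta> p + (- k * b p) *\<^sub>R \<xi> p"
    by simp
  then have "normal_curvature M X Y \<zeta> p
      = k *\<^sub>R (lorentz (\<zeta> p) (\<theta> p) *\<^sub>R \<xi> p - lorentz (\<zeta> p) (\<xi> p) *\<^sub>R \<theta> p)"
    by (simp add: a_def b_def scaleR_right_diff_distrib)
  then show ?thesis
    unfolding k_def ht_def .
qed

text \<open>\<open>d\<alpha> \<and> ds\<close> vanishes exactly when \<open>d\<alpha>\<close> is a multiple of \<open>ds\<close>, that is, when \<open>d\<alpha>\<close> vanishes on the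
  kernel of \<open>ds\<close>. On the tangent space \<open>ds\<close> is the product with \<open>e\<^sub>1\<close>, and so its kernel is
  \<open>Dperp\<close>.\<close>

lemma flat_normal_bundle_iff:
  "flat_normal_bundle M \<longleftrightarrow>
    (\<forall>p\<in>points M. \<forall>w\<in>Dperp M p. deriv_along M conn_coeff p w = 0)"
proof
  assume flat: "flat_normal_bundle M"
  show "\<forall>p\<in>points M. \<forall>w\<in>Dperp M p. deriv_along M conn_coeff p w = 0"
  proof (intro ballI)
    fix p w assume p: "p \<in> points M" and w: "w \<in> Dperp M p"
    have tan: "w \<in> tangent_space M p"
      using w unfolding Dperp_def by blast
    have orth: "lorentz w axis_last = 0"
      using w lorentz_e1_tangent[OF p tan] unfolding Dperp_def by simp
    \<comment> \<open>The curvature is tested on \<open>\<theta>\<close> and on the tangential parts of the constant vectors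
        \<open>w\<close> and \<open>axis_last\<close>, whose values at \<open>p\<close> are \<open>w\<close> and \<open>e\<^sub>1\<close>.\<close>
    have X: "tangential_part M p w = w"
      using xi_tangent[OF p tan] theta_tangent[OF p tan]
      by (simp add: tangential_part_eq[OF p] lorentz_commute[of w])
    have "normal_field M \<theta>"
      using smooth_theta theta_tangent unfolding normal_field_def normal_space_def by blast
    then have "normal_curvature M (\<lambda>p. tangential_part M p w) (\<lambda>p. tangential_part M p axis_last) \<theta> p = 0"
      using flat p tangential_part_tangent_field unfolding flat_normal_bundle_def by blast
    then have "deriv_along M conn_coeff p w *\<^sub>R \<theta> p = 0"
      using normal_curvature_eq[OF tangential_part_tangent_field[of w]
          tangential_part_tangent_field[of axis_last] \<open>normal_field M \<theta>\<close> p]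
        lorentz_e1_axis[OF p] xi_theta[OF p] theta_null[OF p] orth
      by (simp add: X e1_field_def lorentz_commute[of "\<theta> p" "\<xi> p"])
    moreover have "\<theta> p \<noteq> 0"
      using xi_theta[OF p] by (auto simp: lorentz.zero_right)
    ultimately show "deriv_along M conn_coeff p w = 0" by simp
  qed
next
  assume orth: "\<forall>p\<in>points M. \<forall>w\<in>Dperp M p. deriv_along M conn_coeff p w = 0"
  show "flat_normal_bundle M"
    unfolding flat_normal_bundle_def
  proof (intro allI impI ballI)
    fix X Y \<zeta> p
    assume XY: "tangent_field M X" "tangent_field M Y" and \<zeta>: "normal_field M \<zeta>" and p: "p \<in> points M"
    have e1: "deriv_along M conn_coeff p w = lorentz w axis_last * deriv_along M conn_coeff p (e1_field M p)"
      if w: "w \<in> tangent_space M p" for w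
    proof -
      let ?v = "w - lorentz w axis_last *\<^sub>R e1_field M p"
      have sc: "lorentz w axis_last *\<^sub>R e1_field M p \<in> tangent_space M p"
        by (rule subspace_scale[OF subspace_tangent_space[OF p] e1_tangent[OF p]])
      have v: "?v \<in> tangent_space M p"
        by (rule subspace_diff[OF subspace_tangent_space[OF p] w sc])
      have "?v \<in> Dperp M p"
        using v lorentz_e1_tangent[OF p v] lorentz_e1_axis[OF p]
        by (simp add: Dperp_def lorentz.diff_left lorentz.scaleR_left)
      then have "deriv_along M conn_coeff p ?v = 0"
        using orth p by blast
      then show ?thesis
        using differential_linear(1)[OF smooth_map_has_differential[OF smooth_conn] p v sc]
          differential_linear(2)[OF smooth_map_has_differential[OF smooth_conn] p e1_tangent[OF p] w]
        by simp
    qed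
    have "X p \<in> tangent_space M p" "Y p \<in> tangent_space M p"
      using XY p unfolding tangent_field_def by auto
    then show "normal_curvature M X Y \<zeta> p = 0"
      using e1[of "X p"] e1[of "Y p"] by (simp add: normal_curvature_eq[OF XY \<zeta> p])
  qed
qed

end

section \<open>Flatness of the normal bundle\<close>

theorem corollary3p4:
  fixes M :: "('a, 'n::finite) submfd"
    and e :: "nat \<Rightarrow> 'a \<Rightarrow> 'n mink"
    and \<xi> :: "'a \<Rightarrow> 'n mink"
    and \<alpha> :: "'a \<Rightarrow> real"
  assumes "CARD('n) \<ge> 2"
    and "riemannian_submanifold M"
    and "pos M ` points M \<subseteq> light_cone_cylinder"
    and "adapted_frame M e \<xi> \<alpha>"
    and "\<forall>p\<in>points M. \<alpha> p \<noteq> 0"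
  shows "flat_normal_bundle M \<longleftrightarrow>
    (\<forall>a\<in>{2..CARD('n)}. \<forall>p\<in>points M. deriv_along M \<alpha> p (e a p) = 0)"
proof -
  note frame = assms(4)[unfolded adapted_frame_def]
  interpret cone_submfd M \<xi>
    using assms(2,3) frame by unfold_locales auto
  have \<alpha>: "\<alpha> p = conn_coeff p" if p: "p \<in> points M" for p
  proof -
    have e1: "e 1 p = e1_field M p" using frame p by blast
    \<comment> \<open>The defining equation of \<open>\<alpha>\<close> is the case of coefficients \<open>1\<close> and \<open>0\<close>.\<close>
    have "normal_connection M (e 1) \<theta> p = conn_coeff p *\<^sub>R \<theta> p"
      using normal_connection_eq[OF p, of "e 1", OF _ has_differential_const[of M 1]
          has_differential_const[of M 0], of \<theta>] e1_tangent[OF p] lorentz_e1_axis[OF p]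
      by (simp add: e1 del: One_nat_def)
    then have "\<alpha> p *\<^sub>R \<theta> p = conn_coeff p *\<^sub>R \<theta> p"
      using frame p by simp
    moreover have "\<theta> p \<noteq> 0"
      using xi_theta[OF p] by (auto simp: lorentz.zero_right)
    ultimately show ?thesis by simp
  qed
  have span: "span ((\<lambda>a. e a p) ` {2..CARD('n)}) = Dperp M p" if "p \<in> points M" for p
    using frame that by blast
  have Dperp_tangent: "Dperp M p \<subseteq> tangent_space M p" for p
    unfolding Dperp_def by blast
  have deriv: "deriv_along M \<alpha> p w = deriv_along M conn_coeff p w"
    if "p \<in> points M" "w \<in> tangent_space M p" for p w
    using deriv_along_eq[OF has_differential_cong[OF smooth_map_has_differential[OF smooth_conn]]
        that(2), of \<alpha>] \<alpha> by simp
  have "(\<forall>w\<in>Dperp M p. deriv_along M conn_coeff p w = 0)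
      \<longleftrightarrow> (\<forall>a\<in>{2..CARD('n)}. deriv_along M \<alpha> p (e a p) = 0)" if p: "p \<in> points M" for p
  proof
    assume "\<forall>w\<in>Dperp M p. deriv_along M conn_coeff p w = 0"
    moreover have "e a p \<in> Dperp M p" if "a \<in> {2..CARD('n)}" for a
      using span_base[of "e a p" "(\<lambda>a. e a p) ` {2..CARD('n)}"] span[OF p] that by blast
    ultimately show "\<forall>a\<in>{2..CARD('n)}. deriv_along M \<alpha> p (e a p) = 0"
      using deriv[OF p] Dperp_tangent by (metis subsetD)
  next
    assume frame0: "\<forall>a\<in>{2..CARD('n)}. deriv_along M \<alpha> p (e a p) = 0"
    \<comment> \<open>The kernel of \<open>d\<alpha>\<close> is a subspace, so it contains \<open>Dperp\<close> once it contains a frame of it.\<close>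
    let ?K = "{w \<in> tangent_space M p. deriv_along M conn_coeff p w = 0}"
    note lin = differential_linear[OF smooth_map_has_differential[OF smooth_conn] p]
    have sub: "subspace (tangent_space M p)" by (rule subspace_tangent_space[OF p])
    have subspace_K: "subspace ?K"
    proof (rule subspaceI)
      show "0 \<in> ?K"
        using lin(2)[OF subspace_0[OF sub] subspace_0[OF sub], of 0] subspace_0[OF sub] by simp
      show "v + w \<in> ?K" if "v \<in> ?K" "w \<in> ?K" for v w
        using lin(1)[of v w] subspace_add[OF sub, of v w] that by simp
      show "c *\<^sub>R v \<in> ?K" if "v \<in> ?K" for c v
        using lin(2)[of v v c] subspace_scale[OF sub, of v c] that by simp
    qed
    have frame_K: "(\<lambda>a. e a p) ` {2..CARD('n)} \<subseteq> ?K"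
    proof
      fix w assume "w \<in> (\<lambda>a. e a p) ` {2..CARD('n)}"
      then obtain a where a: "a \<in> {2..CARD('n)}" "w = e a p" by blast
      have w: "w \<in> tangent_space M p"
        using span_base[of w "(\<lambda>a. e a p) ` {2..CARD('n)}"] span[OF p] Dperp_tangent a by blast
      have "deriv_along M \<alpha> p w = 0"
        unfolding a(2) by (rule bspec[OF frame0 a(1)])
      then show "w \<in> ?K"
        using w deriv[OF p w] by simp
    qed
    have "Dperp M p \<subseteq> ?K"
      by (rule span_minimal[OF frame_K subspace_K, unfolded span[OF p]])
    then show "\<forall>w\<in>Dperp M p. deriv_along M conn_coeff p w = 0" by blast
  qed
  then show ?thesis
    unfolding flat_normal_bundle_iff by blast
qed

end
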